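(* Let $K\ge 1$, let $P\in\mathbb{R}^{K\times K}$ be a substochastic matrix that is convergent (i.e. has spectral radius strictly less than $1$), and set $R=I-P^T$. Let $(\alpha,\mu)\in(\mathbb{D}^\uparrow_{\mathcal M})^K\times(\mathbb{D}^\uparrow)^K$ with $\mu(0)=0$. Then there exists a unique $(\xi,\beta,\iota)\in\mathbb{D}_{\mathcal M}^K\times(\mathbb{D}^\uparrow_{\mathcal M})^K\times(\mathbb{D}^\uparrow)^K$ such that for every $x\in\mathbb{R}_+$: (1) $\xi[0,x]=\alpha[0,x]-R\,\beta[0,x]$ (as an identity of $\mathbb{R}^K$-valued paths); (2) $\int_{[0,\infty)}\xi^i_s[0,x]\,d\beta^i_s(x,\infty)=0$ for all $i\in\{1,\dots,K\}$; (3) $\int_{[0,\infty)}\xi^i_s[0,x]\,d\iota^i(s)=0$ for all $i\in\{1,\dots,K\}$; (4) $\beta[0,\infty)+\iota=\mu$. (Here the integration variable in (2),(3) is $s$.)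
   Context: $\mathbb{R}_+=[0,\infty)$. $\mathcal M$ is the space of finite Borel measures on $\mathbb{R}_+$ with the topology of weak convergence. $\mathbb{D}$ denotes càdlàg functions $\mathbb{R}_+\to\mathbb{R}$, $\mathbb{D}^\uparrow$ its subset of nondecreasing nonnegative functions, and $\mathbb{D}_{\mathcal M}$ the càdlàg functions $\mathbb{R}_+\to\mathcal M$. $\mathbb{D}^\uparrow_{\mathcal M}$ is the set of $\zeta\in\mathbb{D}_{\mathcal M}$ such that $t\mapsto\int f\,d\zeta_t$ is nondecreasing for every continuous bounded nonnegative $f$. Superscript $K$ denotes $K$-fold products; for $\zeta=(\zeta^1,\dots,\zeta^K)$ and a Borel set $B$, $\zeta_t(B)=(\zeta^1_t(B),\dots,\zeta^K_t(B))$. We write $\zeta[a,b]$ for $\zeta([a,b])$ etc. A triple satisfying (1)–(4) is called a solution of the vector measure valued Skorokhod problem (VMVSP) associated with $P$ for the data $(\alpha,\mu)$. *)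

theory Defs
  imports "HOL-Analysis.Analysis" "Jordan_Normal_Form.Spectral_Radius"
begin

text \<open>Finite Borel measures on R_+ are represented as finite Borel measures on the
reals (space UNIV, sets borel) which put no mass on the negative half-line.\<close>
definition fin_meas_Rp :: "real measure \<Rightarrow> bool" where
  "fin_meas_Rp M \<longleftrightarrow> sets M = sets borel \<and> finite_measure M \<and> emeasure M {..<0} = 0"

definition weak_conv_along :: "'b filter \<Rightarrow> ('b \<Rightarrow> real measure) \<Rightarrow> real measure \<Rightarrow> bool" where
  "weak_conv_along F \<zeta> \<nu> \<longleftrightarrow>
     (\<forall>f :: real \<Rightarrow> real. continuous_on UNIV f \<and> bounded (range f) \<longrightarrow>
        ((\<lambda>s. integral\<^sup>L (\<zeta> s) f) \<longlongrightarrow> integral\<^sup>L \<nu> f) F)"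

text \<open>D: cadlag real functions on R_+ (values at negative times are irrelevant).\<close>
definition cadlag :: "(real \<Rightarrow> real) \<Rightarrow> bool" where
  "cadlag g \<longleftrightarrow> (\<forall>t\<ge>0. (g \<longlongrightarrow> g t) (at_right t)) \<and>
                 (\<forall>t>0. \<exists>l. (g \<longlongrightarrow> l) (at_left t))"

definition D_up :: "(real \<Rightarrow> real) \<Rightarrow> bool" where
  "D_up g \<longleftrightarrow> cadlag g \<and> mono_on {0..} g \<and> (\<forall>t\<ge>0. 0 \<le> g t)"

definition cadlag_M :: "(real \<Rightarrow> real measure) \<Rightarrow> bool" where
  "cadlag_M \<zeta> \<longleftrightarrow> (\<forall>t\<ge>0. fin_meas_Rp (\<zeta> t)) \<and>
     (\<forall>t\<ge>0. weak_conv_along (at_right t) \<zeta> (\<zeta> t)) \<and>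
     (\<forall>t>0. \<exists>\<nu>. fin_meas_Rp \<nu> \<and> weak_conv_along (at_left t) \<zeta> \<nu>)"

definition D_up_M :: "(real \<Rightarrow> real measure) \<Rightarrow> bool" where
  "D_up_M \<zeta> \<longleftrightarrow> cadlag_M \<zeta> \<and>
     (\<forall>f :: real \<Rightarrow> real. continuous_on UNIV f \<and> bounded (range f) \<and> (\<forall>x. 0 \<le> f x) \<longrightarrow>
        mono_on {0..} (\<lambda>t. integral\<^sup>L (\<zeta> t) f))"

text \<open>Lebesgue--Stieltjes measure on [0,inf) of a nondecreasing right-continuous
function g on R_+ (with the convention g(0-) = 0).\<close>
definition stieltjes :: "(real \<Rightarrow> real) \<Rightarrow> real measure" where
  "stieltjes g = interval_measure (\<lambda>s. if s < 0 then 0 else g s)"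

definition substochastic :: "nat \<Rightarrow> real mat \<Rightarrow> bool" where
  "substochastic K P \<longleftrightarrow> P \<in> carrier_mat K K \<and>
     (\<forall>i<K. \<forall>j<K. 0 \<le> P $$ (i, j)) \<and> (\<forall>i<K. (\<Sum>j<K. P $$ (i, j)) \<le> 1)"

definition VMVSP ::
  "nat \<Rightarrow> real mat \<Rightarrow> (nat \<Rightarrow> real \<Rightarrow> real measure) \<Rightarrow> (nat \<Rightarrow> real \<Rightarrow> real)
   \<Rightarrow> (nat \<Rightarrow> real \<Rightarrow> real measure) \<Rightarrow> (nat \<Rightarrow> real \<Rightarrow> real measure) \<Rightarrow> (nat \<Rightarrow> real \<Rightarrow> real) \<Rightarrow> bool"
where
  "VMVSP K P \<alpha> \<mu> \<xi> \<beta> \<iota> \<longleftrightarrow>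
     (let R = 1\<^sub>m K - transpose_mat P in
     (\<forall>i<K. cadlag_M (\<xi> i) \<and> D_up_M (\<beta> i) \<and> D_up (\<iota> i)) \<and>
     (\<forall>x\<ge>0.
        (\<forall>i<K. \<forall>t\<ge>0. measure (\<xi> i t) {0..x} =
              measure (\<alpha> i t) {0..x} - (\<Sum>j<K. R $$ (i, j) * measure (\<beta> j t) {0..x})) \<and>
        (\<forall>i<K. (\<integral>\<^sup>+ s \<in> {0..}. ennreal (measure (\<xi> i s) {0..x})
                 \<partial>stieltjes (\<lambda>s. measure (\<beta> i s) {x<..})) = 0) \<and>
        (\<forall>i<K. (\<integral>\<^sup>+ s \<in> {0..}. ennreal (measure (\<xi> i s) {0..x}) \<partial>stieltjes (\<iota> i)) = 0)) \<and>
     (\<forall>i<K. \<forall>t\<ge>0. measure (\<beta> i t) {0..} + \<iota> i t = \<mu> i t))"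

end

theory Submission
  imports Defs "HOL-Probability.Distribution_Functions"
begin

text \<open>
  Fix a level \<open>x\<close> and put \<open>b = \<beta>[0,x]\<close>. Conditions (1)--(4) say that \<open>\<mu> - b = \<beta>(x,\<infinity>) + \<iota>\<close> is
  the regulator of the Skorokhod problem in the orthant with reflection matrix \<open>R = I - P\<^sup>T\<close>;
  equivalently, \<open>b\<close> solves the fixed point equation \<open>b = serve \<mu> (\<alpha>[0,x] + P\<^sup>T b)\<close> for the
  one-dimensional reflection map. The map \<open>serve\<close> is monotone for the order that compares all
  increments of two paths. Hence iteration from \<open>0\<close> converges to the least solution, and this
  solution depends on \<open>\<alpha>[0,x]\<close> monotonically in the same order, so that \<open>b\<close> is jointly a distribution
  function in \<open>x\<close> and \<open>t\<close>.

  With \<open>w = (I - P)\<^sup>-\<^sup>1 1 \<ge> 0\<close>, the inequality \<open>d \<le> e + P\<^sup>T d\<close> implies \<open>\<Sum> d \<le> \<Sum> w e\<close>. This single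
  estimate gives uniqueness of the fixed point (\<open>e = 0\<close>), right continuity in \<open>x\<close>, and convergence
  to the total mass as \<open>x \<rightarrow> \<infinity>\<close>.
\<close>

section \<open>Paths ordered by their increments\<close>

text \<open>The pointwise order is too weak: the throughput at level y minus that at level x must
  itself be nondecreasing in time, since it is to be the mass that \<beta> puts on (x,y].
  \<open>f \<preceq> g\<close> therefore asks that \<open>g - f\<close> be nonnegative at 0 and
  nondecreasing. The order also transports regularity: a path whose increments lie between 0 and
  those of \<mu> is right continuous with \<mu>. The integrals (2) and (3) are traded for three
  pathwise statements about the integrator at times where the queue is positive: it stays constant
  while the queue stays positive, it does not jump at such a time, and it vanishes at time 0 if the
  queue is positive there. The last one reflects the atom that the convention g(0-) = 0 puts at 0.
  These statements single out the regulator among the nondecreasing paths that keep the queue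
  nonnegative, and they pass to every nondecreasing path below the regulator in
  \<open>\<preceq>\<close>. This is why (2) and (3) can be treated together: \<beta>(x,\<infinity>)
  and \<iota> are two nondecreasing summands of one regulator.\<close>

definition strong_le :: "(real \<Rightarrow> real) \<Rightarrow> (real \<Rightarrow> real) \<Rightarrow> bool"  (infix \<open>\<preceq>\<close> 50) where
  "f \<preceq> g \<longleftrightarrow> f 0 \<le> g 0 \<and> (\<forall>s t. 0 \<le> s \<longrightarrow> s \<le> t \<longrightarrow> f t - f s \<le> g t - g s)"

abbreviation zero_path :: "real \<Rightarrow> real"  (\<open>\<zero>\<^sub>p\<close>) where
  "\<zero>\<^sub>p \<equiv> (\<lambda>_. 0)"

lemma strong_leI:
  assumes "f 0 \<le> g 0" "\<And>s t. 0 \<le> s \<Longrightarrow> s \<le> t \<Longrightarrow> f t - f s \<le> g t - g s"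
  shows "f \<preceq> g"
  using assms by (auto simp: strong_le_def)

lemma strong_le_incr: "f \<preceq> g \<Longrightarrow> 0 \<le> s \<Longrightarrow> s \<le> t \<Longrightarrow> f t - f s \<le> g t - g s"
  by (auto simp: strong_le_def)

lemma strong_le_le: "f \<preceq> g \<Longrightarrow> 0 \<le> t \<Longrightarrow> f t \<le> g t"
  unfolding strong_le_def by (smt (verit))

lemma strong_le_refl [simp]: "f \<preceq> f"
  by (simp add: strong_le_def)

lemma strong_le_trans: "f \<preceq> g \<Longrightarrow> g \<preceq> h \<Longrightarrow> f \<preceq> h"
  unfolding strong_le_def by (smt (verit))

lemma strong_le_cong:
  "f \<preceq> g \<Longrightarrow> (\<And>t. 0 \<le> t \<Longrightarrow> f t = f' t) \<Longrightarrow> (\<And>t. 0 \<le> t \<Longrightarrow> g t = g' t) \<Longrightarrow> f' \<preceq> g'"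
  unfolding strong_le_def by (metis order.trans order_refl)

lemma strong_le_add: "f \<preceq> g \<Longrightarrow> f' \<preceq> g' \<Longrightarrow> (\<lambda>t. f t + f' t) \<preceq> (\<lambda>t. g t + g' t)"
  unfolding strong_le_def by (smt (verit))

lemma strong_le_scale: "f \<preceq> g \<Longrightarrow> 0 \<le> c \<Longrightarrow> (\<lambda>t. c * f t) \<preceq> (\<lambda>t. c * g t)"
  unfolding strong_le_def by (auto simp: mult_left_mono simp flip: right_diff_distrib)

lemma strong_le_sum:
  assumes "\<And>j. j \<in> J \<Longrightarrow> f j \<preceq> g j"
  shows "(\<lambda>t. \<Sum>j\<in>J. f j t) \<preceq> (\<lambda>t. \<Sum>j\<in>J. g j t)"
  using assms by (auto simp: strong_le_def simp flip: sum_subtractf intro!: sum_mono)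

lemma strong_le_diff_iff: "\<zero>\<^sub>p \<preceq> (\<lambda>t. g t - f t) \<longleftrightarrow> f \<preceq> g"
  unfolding strong_le_def by (smt (verit))

lemma strong_le_lim:
  assumes "\<And>n. f n \<preceq> g n"
    and "\<And>t. 0 \<le> t \<Longrightarrow> (\<lambda>n. f n t) \<longlonglongrightarrow> F t"
    and "\<And>t. 0 \<le> t \<Longrightarrow> (\<lambda>n. g n t) \<longlonglongrightarrow> G t"
  shows "F \<preceq> G"
proof (rule strong_leI)
  show "F 0 \<le> G 0"
    by (rule LIMSEQ_le[OF assms(2,3)]) (auto intro: strong_le_le assms(1))
  fix s t :: real assume st: "0 \<le> s" "s \<le> t"
  show "F t - F s \<le> G t - G s"
  proof (rule LIMSEQ_le)
    show "(\<lambda>n. f n t - f n s) \<longlonglongrightarrow> F t - F s" "(\<lambda>n. g n t - g n s) \<longlonglongrightarrow> G t - G s"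
      using st by (auto intro!: tendsto_diff assms)
    show "\<exists>N. \<forall>n\<ge>N. f n t - f n s \<le> g n t - g n s"
      using st strong_le_incr[OF assms(1)] by blast
  qed
qed

lemma strong_le_pos_mono: "\<zero>\<^sub>p \<preceq> f \<Longrightarrow> 0 \<le> s \<Longrightarrow> s \<le> t \<Longrightarrow> f s \<le> f t"
  using strong_le_incr[of "\<zero>\<^sub>p" f s t] by simp

lemma strong_le_pos_left_limit:
  assumes "\<zero>\<^sub>p \<preceq> g" "0 < t"
  shows "\<exists>l. (g \<longlongrightarrow> l) (at_left t)"
proof -
  define l where "l = (SUP s\<in>{0..<t}. g s)"
  have bdd: "bdd_above (g ` {0..<t})"
    by (rule bdd_aboveI[of _ "g t"]) (use assms in \<open>auto intro: strong_le_pos_mono\<close>)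
  have ev: "eventually (\<lambda>s. 0 < s \<and> s < t) (at_left t)"
    using eventually_at_left_real[OF assms(2)] by (rule eventually_mono) auto
  have "(g \<longlongrightarrow> l) (at_left t)"
  proof (rule increasing_tendsto)
    show "\<forall>\<^sub>F s in at_left t. g s \<le> l"
      using ev by (rule eventually_mono) (auto simp: l_def intro!: cSUP_upper bdd)
    fix y assume "y < l"
    then obtain s where s: "0 \<le> s" "s < t" "y < g s"
      unfolding l_def using less_cSUP_iff[OF _ bdd, of y] assms(2) by auto
    show "\<forall>\<^sub>F u in at_left t. y < g u"
      using eventually_at_left_real[OF s(2)]
    proof (rule eventually_mono)
      fix u assume "u \<in> {s<..<t}"
      then show "y < g u"
        using s assms strong_le_pos_mono[of g s u] by simp
    qed
  qed
  then show ?thesis ..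
qed

text \<open>A nondecreasing path has left limits automatically, so right continuity is the only
  regularity left to track.\<close>

lemma D_up_iff:
  "D_up g \<longleftrightarrow> \<zero>\<^sub>p \<preceq> g \<and> (\<forall>t\<ge>0. (g \<longlongrightarrow> g t) (at_right t))"
proof
  assume "D_up g"
  then show "\<zero>\<^sub>p \<preceq> g \<and> (\<forall>t\<ge>0. (g \<longlongrightarrow> g t) (at_right t))"
    by (auto simp: D_up_def cadlag_def strong_le_def mono_on_def)
next
  assume "\<zero>\<^sub>p \<preceq> g \<and> (\<forall>t\<ge>0. (g \<longlongrightarrow> g t) (at_right t))"
  then show "D_up g"
    using strong_le_le[of "\<zero>\<^sub>p" g] strong_le_pos_left_limit[of g]
    by (auto simp: D_up_def cadlag_def mono_on_def intro: strong_le_pos_mono)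
qed

text \<open>The increments of \<open>f\<close> after \<open>t\<close> lie between 0 and those of
  \<open>g\<close>, so right continuity descends along \<open>\<preceq>\<close>. The limit of the
  iterates acquires it in this way from the potential service.\<close>

lemma right_cont_strong_le:
  assumes "\<zero>\<^sub>p \<preceq> f" "f \<preceq> g" "(g \<longlongrightarrow> g t) (at_right t)" "0 \<le> t"
  shows "(f \<longlongrightarrow> f t) (at_right t)"
proof (rule tendsto_sandwich[of "\<lambda>_. f t" f "at_right t" "\<lambda>s. f t + (g s - g t)"])
  have ev: "eventually (\<lambda>s. t < s) (at_right t)"
    by (simp add: eventually_at_filter)
  show "\<forall>\<^sub>F s in at_right t. f t \<le> f s"
    using ev by (rule eventually_mono) (use assms in \<open>auto intro: strong_le_pos_mono\<close>)
  show "\<forall>\<^sub>F s in at_right t. f s \<le> f t + (g s - g t)"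
    using ev
  proof (rule eventually_mono)
    fix s assume "t < s"
    then show "f s \<le> f t + (g s - g t)"
      using strong_le_incr[OF assms(2,4), of s] by simp
  qed
  show "((\<lambda>s. f t + (g s - g t)) \<longlongrightarrow> f t) (at_right t)"
    using assms(3) by (auto intro!: tendsto_eq_intros)
qed auto

section \<open>One-dimensional reflection\<close>

text \<open>For arrivals \<open>c\<close> and potential service \<open>m\<close>, \<open>idle\<close> is the Skorokhod regulator of \<open>c - m\<close>,
  \<open>serve\<close> is the actual departure process, and \<open>c - serve m c\<close> is the reflected path.\<close>

definition idle :: "(real \<Rightarrow> real) \<Rightarrow> (real \<Rightarrow> real) \<Rightarrow> real \<Rightarrow> real" where
  "idle m c t = (SUP s\<in>{0..t}. max 0 (m s - c s))"

definition serve :: "(real \<Rightarrow> real) \<Rightarrow> (real \<Rightarrow> real) \<Rightarrow> real \<Rightarrow> real" where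
  "serve m c t = m t - idle m c t"

section \<open>Monotonicity of the regulator in the arrivals\<close>

lemma idle_least:
  assumes "0 \<le> t" "0 \<le> y" "\<And>s. 0 \<le> s \<Longrightarrow> s \<le> t \<Longrightarrow> m s - c s \<le> y"
  shows "idle m c t \<le> y"
  unfolding idle_def using assms by (intro cSUP_least) auto

lemma idle_upper_max:
  assumes "\<zero>\<^sub>p \<preceq> m" "\<zero>\<^sub>p \<preceq> c" "0 \<le> s" "s \<le> t"
  shows "max 0 (m s - c s) \<le> idle m c t"
  unfolding idle_def
proof (rule cSUP_upper)
  show "bdd_above ((\<lambda>s. max 0 (m s - c s)) ` {0..t})"
  proof (rule bdd_aboveI2)
    fix u assume "u \<in> {0..t}"
    then show "max 0 (m u - c u) \<le> m t"
      using strong_le_pos_mono[OF assms(1), of u t] strong_le_le[OF assms(2), of u]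
        strong_le_le[OF assms(1), of u] by auto
  qed
qed (use assms in auto)

lemma idle_upper:
  "\<zero>\<^sub>p \<preceq> m \<Longrightarrow> \<zero>\<^sub>p \<preceq> c \<Longrightarrow> 0 \<le> s \<Longrightarrow> s \<le> t \<Longrightarrow> m s - c s \<le> idle m c t"
  using idle_upper_max[of m c s t] by simp

lemma idle_nonneg:
  "\<zero>\<^sub>p \<preceq> m \<Longrightarrow> \<zero>\<^sub>p \<preceq> c \<Longrightarrow> 0 \<le> t \<Longrightarrow> 0 \<le> idle m c t"
  using idle_upper_max[of m c 0 t] by simp

lemma idle_approx:
  assumes "0 \<le> t" "0 \<le> y" "y < idle m c t"
  obtains s where "0 \<le> s" "s \<le> t" "y < m s - c s"
  using idle_least[OF assms(1,2), of m c] assms(3) by (meson linorder_not_le)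

lemma idle_mono:
  assumes "\<zero>\<^sub>p \<preceq> m" "\<zero>\<^sub>p \<preceq> c" "0 \<le> s" "s \<le> t"
  shows "idle m c s \<le> idle m c t"
  by (rule idle_least) (use assms in \<open>auto intro: idle_upper idle_nonneg\<close>)

text \<open>The extra arrivals \<open>c' - c\<close> up to any \<open>s \<le> t\<close> are at most
  those up to \<open>t\<close>, so raising the arrivals lowers the regulator by no more than their
  excess at \<open>t\<close>.\<close>

lemma idle_le_add:
  assumes "\<zero>\<^sub>p \<preceq> m" "\<zero>\<^sub>p \<preceq> c" "c \<preceq> c'" "0 \<le> t"
  shows "idle m c t \<le> idle m c' t + (c' t - c t)"
proof (rule idle_least)
  have c': "\<zero>\<^sub>p \<preceq> c'"
    using assms strong_le_trans by blast
  show "0 \<le> idle m c' t + (c' t - c t)"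
    using idle_nonneg[OF assms(1) c' assms(4)] strong_le_le[OF assms(3,4)] by simp
  fix s assume s: "0 \<le> s" "s \<le> t"
  show "m s - c s \<le> idle m c' t + (c' t - c t)"
    using idle_upper[OF assms(1) c' s] strong_le_incr[OF assms(3) s] by simp
qed (use assms in auto)

text \<open>Bound each \<open>m u - c' u\<close> with \<open>u \<le> t\<close>. For
  \<open>u \<le> s\<close> it is already counted in \<open>idle m c' s\<close>. For
  \<open>u > s\<close> the excess \<open>c' u - c u\<close> is at least \<open>c' s - c s\<close>,
  which by \<open>idle_le_add\<close> at time \<open>s\<close> is at least
  \<open>idle m c s - idle m c' s\<close>; this is the amount to be subtracted from
  \<open>idle m c t\<close>.\<close>

lemma idle_antimono:
  assumes m: "\<zero>\<^sub>p \<preceq> m" and c: "\<zero>\<^sub>p \<preceq> c" and cc': "c \<preceq> c'"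
  shows "idle m c' \<preceq> idle m c"
proof (rule strong_leI)
  have c': "\<zero>\<^sub>p \<preceq> c'"
    using c cc' strong_le_trans by blast
  show "idle m c' 0 \<le> idle m c 0"
    by (rule idle_least)
      (use idle_upper[OF m c, of _ 0] idle_nonneg[OF m c, of 0] strong_le_le[OF cc'] in force)+
  fix s t :: real assume st: "0 \<le> s" "s \<le> t"
  have "idle m c' t \<le> idle m c' s + (idle m c t - idle m c s)"
  proof (rule idle_least)
    have up: "0 \<le> idle m c t - idle m c s"
      using idle_mono[OF m c st] by simp
    show "0 \<le> idle m c' s + (idle m c t - idle m c s)"
      using idle_nonneg[OF m c' st(1)] up by simp
    fix u assume u: "0 \<le> u" "u \<le> t"
    show "m u - c' u \<le> idle m c' s + (idle m c t - idle m c s)"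
    proof (cases "u \<le> s")
      case True
      then show ?thesis
        using idle_upper[OF m c' u(1) True] up by simp
    next
      case False
      then show ?thesis
        using idle_upper[OF m c u] idle_le_add[OF m c cc' st(1)]
          strong_le_incr[OF cc' st(1), of u] by simp
    qed
  qed (use st in simp)
  then show "idle m c' t - idle m c' s \<le> idle m c t - idle m c s"
    by simp
qed

lemma idle_pos: "\<zero>\<^sub>p \<preceq> m \<Longrightarrow> \<zero>\<^sub>p \<preceq> c \<Longrightarrow> \<zero>\<^sub>p \<preceq> idle m c"
  by (auto intro!: strong_leI idle_nonneg simp: idle_mono)

text \<open>Compare with zero arrivals, where all potential service is idle and the regulator is
  \<open>m\<close> itself.\<close>

lemma idle_strong_le:
  assumes "\<zero>\<^sub>p \<preceq> m" "\<zero>\<^sub>p \<preceq> c"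
  shows "idle m c \<preceq> m"
proof -
  have "idle m \<zero>\<^sub>p t = m t" if "0 \<le> t" for t
    by (intro antisym idle_least)
      (use that assms strong_le_le[OF assms(1)] idle_upper[OF assms(1), of "\<zero>\<^sub>p" t t]
        in \<open>auto simp: strong_le_pos_mono\<close>)
  then show ?thesis
    using idle_antimono[OF assms(1) _ assms(2)] by (auto intro: strong_le_cong)
qed

lemma serve_pos: "\<zero>\<^sub>p \<preceq> m \<Longrightarrow> \<zero>\<^sub>p \<preceq> c \<Longrightarrow> \<zero>\<^sub>p \<preceq> serve m c"
  unfolding serve_def[abs_def] by (simp add: strong_le_diff_iff idle_strong_le)

lemma serve_strong_le: "\<zero>\<^sub>p \<preceq> m \<Longrightarrow> \<zero>\<^sub>p \<preceq> c \<Longrightarrow> serve m c \<preceq> m"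
  using idle_pos[of m c] by (simp add: serve_def[abs_def] strong_le_def)

lemma serve_mono:
  "\<zero>\<^sub>p \<preceq> m \<Longrightarrow> \<zero>\<^sub>p \<preceq> c \<Longrightarrow> c \<preceq> c' \<Longrightarrow> serve m c \<preceq> serve m c'"
  using idle_antimono[of m c c'] unfolding serve_def[abs_def] strong_le_def by (smt (verit))

lemma serve_le: "\<zero>\<^sub>p \<preceq> m \<Longrightarrow> \<zero>\<^sub>p \<preceq> c \<Longrightarrow> 0 \<le> t \<Longrightarrow> serve m c t \<le> c t"
  using idle_upper[of m c t t] by (simp add: serve_def)

lemma serve_diff_le:
  "\<zero>\<^sub>p \<preceq> m \<Longrightarrow> \<zero>\<^sub>p \<preceq> c \<Longrightarrow> c \<preceq> c' \<Longrightarrow> 0 \<le> t \<Longrightarrow> serve m c' t - serve m c t \<le> c' t - c t"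
  using idle_le_add[of m c c' t] by (simp add: serve_def)

text \<open>A positive queue means that \<open>m - c\<close> is strictly below its running maximum
  at \<open>s\<close>; by right continuity it stays below for a while, and the maximum does not
  move.\<close>

lemma idle_right_flat:
  assumes m: "\<zero>\<^sub>p \<preceq> m" and c: "\<zero>\<^sub>p \<preceq> c" and s: "0 \<le> s" and q: "serve m c s < c s"
    and rc: "(m \<longlongrightarrow> m s) (at_right s)" "(c \<longlongrightarrow> c s) (at_right s)"
  shows "\<exists>e>0. idle m c (s + e) = idle m c s"
proof -
  have "m s - c s < idle m c s"
    using q by (simp add: serve_def)
  then have "eventually (\<lambda>u. m u - c u < idle m c s) (at_right s)"
    by (rule order_tendstoD(2)[OF tendsto_diff[OF rc]])
  then obtain b where b: "s < b" "\<And>u. s < u \<Longrightarrow> u < b \<Longrightarrow> m u - c u < idle m c s"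
    unfolding eventually_at_right_field by blast
  define e where "e = (b - s) / 2"
  have e: "0 < e" "s + e < b"
    using b(1) by (auto simp: e_def field_simps)
  have "idle m c (s + e) \<le> idle m c s"
  proof (rule idle_least)
    fix u assume "0 \<le> u" "u \<le> s + e"
    then show "m u - c u \<le> idle m c s"
      using b(2)[of u] e idle_upper[OF m c, of u s] by (cases "u \<le> s") auto
  qed (use s e idle_nonneg[OF m c s] in auto)
  with e idle_mono[OF m c s, of "s + e"] show ?thesis
    by (intro exI[of _ e]) auto
qed

text \<open>The value of \<open>m - c\<close> at \<open>s\<close> is too small to contribute to the
  supremum, which is therefore approached by earlier times. Continuity from the left is expressed by
  values of the regulator before \<open>s\<close> that come within \<open>e\<close> of the one at
  \<open>s\<close>.\<close>

lemma idle_no_jump: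
  assumes m: "\<zero>\<^sub>p \<preceq> m" and c: "\<zero>\<^sub>p \<preceq> c" and s: "0 < s" and q: "serve m c s < c s" and e: "0 < e"
  shows "\<exists>u. 0 \<le> u \<and> u < s \<and> idle m c s < idle m c u + e"
proof (cases "idle m c s < e")
  case True
  then show ?thesis
    using s idle_nonneg[OF m c, of 0] by (intro exI[of _ 0]) auto
next
  case False
  \<comment> \<open>Since \<open>y\<close> is at least \<open>m s - c s\<close>, a point where
    \<open>m - c\<close> exceeds \<open>y\<close> cannot be \<open>s\<close> and so lies strictly
    before it.\<close>
  define y where "y = max (idle m c s - e) (max 0 (m s - c s))"
  have "y < idle m c s"
    using False q e by (auto simp: y_def serve_def)
  then obtain v where v: "0 \<le> v" "v \<le> s" "y < m v - c v"
    using idle_approx[of s y m c] s by (metis max.cobounded1 max.coboundedI2 order_less_imp_le y_def)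
  then have "v \<noteq> s"
    by (auto simp: y_def)
  with v idle_upper[OF m c v(1), of v] show ?thesis
    by (intro exI[of _ v]) (auto simp: y_def)
qed

lemma idle_zero:
  assumes "serve m c 0 < c 0"
  shows "idle m c 0 = 0"
proof -
  have "idle m c 0 = max 0 (m 0 - c 0)"
    by (simp add: idle_def)
  then show ?thesis
    using assms by (simp add: serve_def max_def split: if_splits)
qed

text \<open>If \<open>h\<close> exceeded \<open>y = idle m c t\<close> at \<open>t\<close>, take the
  infimum \<open>r\<close> of the times at which it exceeds \<open>y\<close>. At all such times up
  to \<open>t\<close> the constraint \<open>above\<close> is strict, so \<open>flat\<close> makes
  \<open>h\<close> constant on \<open>[r,t]\<close>. Then \<open>h\<close> must have climbed above
  \<open>y\<close> exactly at \<open>r\<close>, which \<open>zero\<close> forbids for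
  \<open>r = 0\<close> and \<open>no_jump\<close> for \<open>r > 0\<close>.\<close>

lemma idle_unique:
  assumes m: "\<zero>\<^sub>p \<preceq> m" and c: "\<zero>\<^sub>p \<preceq> c" and h: "\<zero>\<^sub>p \<preceq> h"
    and above: "\<And>t. 0 \<le> t \<Longrightarrow> m t - c t \<le> h t"
    and flat: "\<And>s t. 0 \<le> s \<Longrightarrow> s < t \<Longrightarrow> (\<And>u. s < u \<Longrightarrow> u \<le> t \<Longrightarrow> m u - c u < h u) \<Longrightarrow> h s = h t"
    and zero: "m 0 - c 0 < h 0 \<Longrightarrow> h 0 = 0"
    and no_jump: "\<And>s e. 0 < s \<Longrightarrow> m s - c s < h s \<Longrightarrow> 0 < e \<Longrightarrow> \<exists>u. 0 \<le> u \<and> u < s \<and> h s < h u + e"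
    and t: "0 \<le> t"
  shows "h t = idle m c t"
proof (rule antisym)
  show "idle m c t \<le> h t"
    by (rule idle_least[OF t])
      (use above strong_le_pos_mono[OF h] strong_le_le[OF h] t in \<open>auto intro: order_trans\<close>)
  show "h t \<le> idle m c t"
  proof (rule ccontr)
    define y where "y = idle m c t"
    assume "\<not> h t \<le> idle m c t"
    then have ty: "y < h t"
      by (simp add: y_def)
    have y0: "0 \<le> y"
      unfolding y_def by (rule idle_nonneg[OF m c t])
    have busy: "m u - c u < h u" if "0 \<le> u" "u \<le> t" "y < h u" for u
      using idle_upper[OF m c that(1,2)] that(3) by (simp add: y_def)
    define U where "U = {u. 0 \<le> u \<and> u \<le> t \<and> y < h u}"
    define r where "r = Inf U"
    have tU: "t \<in> U"
      using t ty by (simp add: U_def)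
    have bdd: "bdd_below U"
      by (rule bdd_belowI[of _ 0]) (auto simp: U_def)
    have r: "0 \<le> r" "r \<le> t"
      unfolding r_def using tU bdd by (auto intro!: cInf_greatest cInf_lower simp: U_def)
    have below: "h u \<le> y" if "0 \<le> u" "u < r" for u
    proof (rule ccontr)
      assume "\<not> h u \<le> y"
      then have "u \<in> U"
        using that r by (auto simp: U_def)
      then show False
        using cInf_lower[OF _ bdd, of u] that by (simp add: r_def)
    qed
    have beyond: "y < h u" if "r < u" "u \<le> t" for u
    proof -
      obtain v where "v \<in> U" "v < u"
        using cInf_lessD[of U u] tU \<open>r < u\<close> unfolding r_def by blast
      then show ?thesis
        using strong_le_pos_mono[OF h, of v u] by (auto simp: U_def)
    qed
    have "h r = h t"
    proof (cases "r = t")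
      case False
      then show ?thesis
        using r by (intro flat busy beyond) auto
    qed simp
    then have hr: "y < h r"
      using ty by simp
    then have q: "m r - c r < h r"
      using r by (intro busy) auto
    show False
    proof (cases "r = 0")
      case True
      then show False
        using zero q hr y0 by auto
    next
      case False
      \<comment> \<open>The tolerance \<open>h r - y\<close> turns the point supplied by
        \<open>no_jump\<close> into a time before \<open>r\<close> with
        \<open>h u > y\<close>.\<close>
      then obtain u where "0 \<le> u" "u < r" "h r < h u + (h r - y)"
        using no_jump[of r "h r - y"] q hr r by auto
      then show False
        using below[of u] by simp
    qed
  qed
qed

section \<open>Networks of reflected paths\<close>

text \<open>Convergence of the routing matrix enters only through the weights: \<open>w i\<close> is
  the expected total number of services received by a customer that enters at station
  \<open>i\<close>.\<close>

locale network =
  fixes K :: nat and p :: "nat \<Rightarrow> nat \<Rightarrow> real" and m :: "nat \<Rightarrow> real \<Rightarrow> real" and w :: "nat \<Rightarrow> real"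
  assumes p_nonneg: "i < K \<Longrightarrow> j < K \<Longrightarrow> 0 \<le> p i j"
    and m_pos: "i < K \<Longrightarrow> \<zero>\<^sub>p \<preceq> m i"
    and w_nonneg: "i < K \<Longrightarrow> 0 \<le> w i"
    and w_eq: "i < K \<Longrightarrow> w i = 1 + (\<Sum>j<K. p i j * w j)"
begin

text \<open>Multiply the i-th inequality by \<open>w i\<close> and sum. Swapping the sums turns the
  transposed term into the sum of \<open>d j * (w j - 1)\<close>, and the terms
  \<open>w j * d j\<close> cancel. The sign of \<open>d\<close> does not matter.\<close>

lemma weighted_bound:
  assumes "\<And>i. i < K \<Longrightarrow> d i \<le> e i + (\<Sum>j<K. p j i * d j)"
  shows "(\<Sum>i<K. d i) \<le> (\<Sum>i<K. w i * e i)"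
proof -
  have "(\<Sum>i<K. w i * d i) \<le> (\<Sum>i<K. w i * (e i + (\<Sum>j<K. p j i * d j)))"
    by (intro sum_mono mult_left_mono assms) (auto simp: w_nonneg)
  also have "\<dots> = (\<Sum>i<K. w i * e i) + (\<Sum>i<K. \<Sum>j<K. w i * (p j i * d j))"
    by (simp add: distrib_left sum.distrib sum_distrib_left)
  also have "(\<Sum>i<K. \<Sum>j<K. w i * (p j i * d j)) = (\<Sum>j<K. d j * (\<Sum>i<K. p j i * w i))"
    by (subst sum.swap) (simp add: sum_distrib_left mult_ac)
  also have "\<dots> = (\<Sum>j<K. d j * (w j - 1))"
  proof (rule sum.cong[OF refl])
    fix j assume "j \<in> {..<K}"
    then have "w j = 1 + (\<Sum>i<K. p j i * w i)"
      by (intro w_eq) simp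
    then have "(\<Sum>i<K. p j i * w i) = w j - 1"
      by linarith
    then show "d j * (\<Sum>i<K. p j i * w i) = d j * (w j - 1)"
      by (rule arg_cong)
  qed
  finally show ?thesis
    by (simp add: algebra_simps sum_subtractf)
qed

section \<open>Fixed point iteration and its least solution\<close>

definition inflow :: "(nat \<Rightarrow> real \<Rightarrow> real) \<Rightarrow> (nat \<Rightarrow> real \<Rightarrow> real) \<Rightarrow> nat \<Rightarrow> real \<Rightarrow> real" where
  "inflow a b i t = a i t + (\<Sum>j<K. p j i * b j t)"

definition throughput_eq :: "(nat \<Rightarrow> real \<Rightarrow> real) \<Rightarrow> (nat \<Rightarrow> real \<Rightarrow> real) \<Rightarrow> bool" where
  "throughput_eq a b \<longleftrightarrow> (\<forall>i<K. \<zero>\<^sub>p \<preceq> b i \<and> (\<forall>t\<ge>0. b i t = serve (m i) (inflow a b i) t))"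

primrec iter :: "(nat \<Rightarrow> real \<Rightarrow> real) \<Rightarrow> nat \<Rightarrow> nat \<Rightarrow> real \<Rightarrow> real" where
  "iter a 0 = (\<lambda>i t. 0)"
| "iter a (Suc n) = (\<lambda>i. serve (m i) (inflow a (iter a n) i))"

definition throughput :: "(nat \<Rightarrow> real \<Rightarrow> real) \<Rightarrow> nat \<Rightarrow> real \<Rightarrow> real" where
  "throughput a i t = lim (\<lambda>n. iter a n i t)"

lemma inflow_mono:
  assumes "\<And>i. i < K \<Longrightarrow> a i \<preceq> a' i" "\<And>i. i < K \<Longrightarrow> b i \<preceq> b' i" "i < K"
  shows "inflow a b i \<preceq> inflow a' b' i"
  unfolding inflow_def[abs_def]
  by (intro strong_le_add strong_le_sum strong_le_scale) (use assms p_nonneg in auto)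

lemma inflow_pos:
  assumes "\<And>i. i < K \<Longrightarrow> \<zero>\<^sub>p \<preceq> a i" "\<And>i. i < K \<Longrightarrow> \<zero>\<^sub>p \<preceq> b i" "i < K"
  shows "\<zero>\<^sub>p \<preceq> inflow a b i"
  using inflow_mono[of "\<lambda>_. \<zero>\<^sub>p" a "\<lambda>_. \<zero>\<^sub>p" b i] assms by (simp add: inflow_def[abs_def])

lemma iter_pos:
  assumes "\<And>i. i < K \<Longrightarrow> \<zero>\<^sub>p \<preceq> a i"
  shows "i < K \<Longrightarrow> \<zero>\<^sub>p \<preceq> iter a n i"
proof (induction n arbitrary: i)
  case (Suc n)
  then show ?case
    unfolding iter.simps by (intro serve_pos m_pos inflow_pos assms)
qed simp

lemma iter_Suc_mono:
  assumes "\<And>i. i < K \<Longrightarrow> \<zero>\<^sub>p \<preceq> a i"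
  shows "i < K \<Longrightarrow> iter a n i \<preceq> iter a (Suc n) i"
proof (induction n arbitrary: i)
  case 0
  then show ?case
    using iter_pos[of a i 1] assms by simp
next
  case (Suc n)
  then show ?case
    unfolding iter.simps(2)[of a n] iter.simps(2)[of a "Suc n"]
    by (intro serve_mono m_pos inflow_pos inflow_mono iter_pos assms strong_le_refl)
qed

lemma iter_strong_le:
  assumes "\<And>i. i < K \<Longrightarrow> \<zero>\<^sub>p \<preceq> a i" "i < K"
  shows "iter a n i \<preceq> m i"
proof (cases n)
  case 0
  then show ?thesis
    using m_pos assms by simp
next
  case (Suc k)
  show ?thesis
    unfolding Suc iter.simps by (intro serve_strong_le m_pos inflow_pos iter_pos assms)
qed

lemma iter_tendsto:
  assumes "\<And>i. i < K \<Longrightarrow> \<zero>\<^sub>p \<preceq> a i" "i < K" "0 \<le> t"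
  shows "(\<lambda>n. iter a n i t) \<longlonglongrightarrow> throughput a i t"
proof -
  have "convergent (\<lambda>n. iter a n i t)"
  proof (rule Bseq_mono_convergent)
    show "\<forall>n n'. n \<le> n' \<longrightarrow> iter a n i t \<le> iter a n' i t"
    proof (intro allI impI)
      fix n n' :: nat assume "n \<le> n'"
      then show "iter a n i t \<le> iter a n' i t"
        by (rule lift_Suc_mono_le[of "\<lambda>n. iter a n i t", rotated])
          (rule strong_le_le[OF iter_Suc_mono[OF assms(1,2)] assms(3)])
    qed
    show "Bseq (\<lambda>n. iter a n i t)"
    proof (rule BseqI')
      fix n
      show "norm (iter a n i t) \<le> m i t"
        using strong_le_le[OF iter_strong_le[of a i n], of t]
          strong_le_le[OF iter_pos[of a i n], of t] assms by simp
    qed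
  qed
  then show ?thesis
    by (simp add: throughput_def convergent_LIMSEQ_iff)
qed

lemma throughput_pos:
  assumes "\<And>i. i < K \<Longrightarrow> \<zero>\<^sub>p \<preceq> a i" "i < K"
  shows "\<zero>\<^sub>p \<preceq> throughput a i"
  by (rule strong_le_lim[OF iter_pos tendsto_const iter_tendsto, of a]) (use assms in auto)

lemma throughput_strong_le:
  assumes "\<And>i. i < K \<Longrightarrow> \<zero>\<^sub>p \<preceq> a i" "i < K"
  shows "throughput a i \<preceq> m i"
  by (rule strong_le_lim[OF iter_strong_le iter_tendsto tendsto_const, of a]) (use assms in auto)

lemma iter_le_throughput:
  assumes "\<And>i. i < K \<Longrightarrow> \<zero>\<^sub>p \<preceq> a i" "i < K"
  shows "iter a n i \<preceq> throughput a i"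
proof (rule strong_le_lim)
  fix k
  show "iter a n i \<preceq> iter a (n + k) i"
    by (induction k) (use iter_Suc_mono[of a i] assms in \<open>auto simp del: iter.simps intro: strong_le_trans\<close>)
next
  fix t :: real assume "0 \<le> t"
  then show "(\<lambda>k. iter a (n + k) i t) \<longlonglongrightarrow> throughput a i t"
    using LIMSEQ_ignore_initial_segment[OF iter_tendsto, of a i t n] assms by (simp add: add.commute)
qed auto

text \<open>Instead of continuity of the supremum in \<open>idle\<close>, a squeeze:
  \<open>serve\<close> of the limiting inflow exceeds the next iterate by at least 0 and at most the
  gap in inflow, which tends to 0.\<close>

lemma throughput_eq_throughput:
  assumes a: "\<And>i. i < K \<Longrightarrow> \<zero>\<^sub>p \<preceq> a i"
  shows "throughput_eq a (throughput a)"
  unfolding throughput_eq_def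
proof (intro allI impI conjI)
  fix i assume i: "i < K"
  show "\<zero>\<^sub>p \<preceq> throughput a i"
    using throughput_pos a i by blast
  fix t :: real assume t: "0 \<le> t"
  let ?c = "\<lambda>n. inflow a (iter a n) i" and ?C = "inflow a (throughput a) i"
  have c: "\<zero>\<^sub>p \<preceq> ?c n" and cC: "?c n \<preceq> ?C" for n
    by (intro inflow_pos iter_pos inflow_mono iter_le_throughput strong_le_refl a i; assumption)+
  have lim: "(\<lambda>n. ?C t - ?c n t) \<longlonglongrightarrow> ?C t - ?C t"
    unfolding inflow_def using a t by (intro tendsto_intros iter_tendsto) auto
  have "(\<lambda>n. serve (m i) ?C t - iter a (Suc n) i t) \<longlonglongrightarrow> 0"
  proof (rule tendsto_sandwich[OF _ _ tendsto_const])
    show "(\<lambda>n. ?C t - ?c n t) \<longlonglongrightarrow> 0"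
      using lim by simp
    show "\<forall>\<^sub>F n in sequentially. 0 \<le> serve (m i) ?C t - iter a (Suc n) i t"
      using strong_le_le[OF serve_mono[OF m_pos[OF i] c cC] t] by simp
    show "\<forall>\<^sub>F n in sequentially. serve (m i) ?C t - iter a (Suc n) i t \<le> ?C t - ?c n t"
      using serve_diff_le[OF m_pos[OF i] c cC t] by simp
  qed
  moreover have "(\<lambda>n. serve (m i) ?C t - iter a (Suc n) i t) \<longlonglongrightarrow> serve (m i) ?C t - throughput a i t"
    by (intro tendsto_intros LIMSEQ_Suc iter_tendsto a i t)
  ultimately show "throughput a i t = serve (m i) ?C t"
    using LIMSEQ_unique by fastforce
qed

text \<open>Each iterate is below \<open>b'\<close> by induction, since \<open>serve\<close> is
  monotone and reproduces \<open>b'\<close> from its own inflow. Allowing data \<open>a'\<close>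
  above \<open>a\<close> yields minimality and monotonicity in the data at once.\<close>

lemma throughput_minimal:
  assumes a: "\<And>i. i < K \<Longrightarrow> \<zero>\<^sub>p \<preceq> a i" and aa': "\<And>i. i < K \<Longrightarrow> a i \<preceq> a' i"
    and b': "throughput_eq a' b'" and i: "i < K"
  shows "throughput a i \<preceq> b' i"
proof (rule strong_le_lim)
  fix n
  show "iter a n i \<preceq> b' i"
    using i
  proof (induction n arbitrary: i)
    case 0
    then show ?case
      using b' by (simp add: throughput_eq_def)
  next
    case (Suc n)
    have "iter a (Suc n) i \<preceq> serve (m i) (inflow a' b' i)"
      unfolding iter.simps
      by (intro serve_mono m_pos inflow_pos inflow_mono iter_pos Suc.IH Suc.prems a aa')
    then show ?case
      by (rule strong_le_cong) (use b' Suc.prems in \<open>auto simp: throughput_eq_def\<close>)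
  qed
qed (auto intro!: iter_tendsto a i)

lemma throughput_mono:
  assumes "\<And>i. i < K \<Longrightarrow> \<zero>\<^sub>p \<preceq> a i" "\<And>i. i < K \<Longrightarrow> a i \<preceq> a' i" "i < K"
  shows "throughput a i \<preceq> throughput a' i"
proof (rule throughput_minimal)
  show "throughput_eq a' (throughput a')"
    using assms strong_le_trans by (intro throughput_eq_throughput) blast
qed (use assms in auto)

text \<open>More inflow raises the output of \<open>serve\<close> by at most the extra inflow, so
  the queue can only grow. Used both for the Lipschitz bound and to make the queue a distribution
  function in the level.\<close>

lemma throughput_eq_diff:
  assumes a: "\<And>i. i < K \<Longrightarrow> \<zero>\<^sub>p \<preceq> a i" and aa': "\<And>i. i < K \<Longrightarrow> a i \<preceq> a' i"
    and b': "throughput_eq a' b'" and t: "0 \<le> t" and i: "i < K"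
  shows "inflow a (throughput a) i t - throughput a i t \<le> inflow a' b' i t - b' i t"
proof -
  let ?b = "throughput a"
  have b: "throughput_eq a ?b"
    by (rule throughput_eq_throughput[OF a])
  have "\<zero>\<^sub>p \<preceq> inflow a ?b i" "inflow a ?b i \<preceq> inflow a' b' i"
    by (intro inflow_pos inflow_mono throughput_pos throughput_minimal[OF _ _ b'] a aa' i; assumption)+
  then have "serve (m i) (inflow a' b' i) t - serve (m i) (inflow a ?b i) t
      \<le> inflow a' b' i t - inflow a ?b i t"
    by (intro serve_diff_le m_pos i t)
  then show ?thesis
    using b b' i t by (simp add: throughput_eq_def)
qed

text \<open>By minimality all differences \<open>b' - throughput a\<close> are nonnegative, so one
  of them is at most their sum, and \<open>throughput_eq_diff\<close> is the hypothesis of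
  \<open>weighted_bound\<close> for these differences.\<close>

lemma throughput_lipschitz:
  assumes a: "\<And>i. i < K \<Longrightarrow> \<zero>\<^sub>p \<preceq> a i" and aa': "\<And>i. i < K \<Longrightarrow> a i \<preceq> a' i"
    and b': "throughput_eq a' b'" and t: "0 \<le> t" and i: "i < K"
  shows "b' i t - throughput a i t \<le> (\<Sum>j<K. w j * (a' j t - a j t))"
proof -
  have nonneg: "0 \<le> b' j t - throughput a j t" if "j < K" for j
    using strong_le_le[OF throughput_minimal[OF a aa' b' that] t] by simp
  have "b' i t - throughput a i t \<le> (\<Sum>j<K. b' j t - throughput a j t)"
    by (rule member_le_sum) (use i nonneg in auto)
  also have "\<dots> \<le> (\<Sum>j<K. w j * (a' j t - a j t))"
  proof (rule weighted_bound)
    fix j assume "j < K"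
    from throughput_eq_diff[OF a aa' b' t this]
    show "b' j t - throughput a j t \<le> a' j t - a j t + (\<Sum>k<K. p k j * (b' k t - throughput a k t))"
      by (simp add: inflow_def right_diff_distrib sum_subtractf)
  qed
  finally show ?thesis .
qed

lemma throughput_unique:
  assumes "\<And>i. i < K \<Longrightarrow> \<zero>\<^sub>p \<preceq> a i" "throughput_eq a b" "i < K" "0 \<le> t"
  shows "b i t = throughput a i t"
  using throughput_lipschitz[of a a b t i] throughput_minimal[of a a b i, THEN strong_le_le, of t]
    assms by simp

text \<open>Meant for levels below 0. Since \<open>serve\<close> never exceeds its inflow,
  \<open>weighted_bound\<close> applies with \<open>e = 0\<close> and bounds the sum of the
  nonnegative throughputs by 0.\<close>

lemma throughput_zero:
  assumes "\<And>i t. i < K \<Longrightarrow> 0 \<le> t \<Longrightarrow> a i t = 0" "i < K" "0 \<le> t"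
  shows "throughput a i t = 0"
proof -
  have "\<zero>\<^sub>p \<preceq> a j" if "j < K" for j
    by (rule strong_leI) (simp_all add: assms(1) that)
  note a = this
  have "(\<Sum>j<K. throughput a j t) \<le> (\<Sum>j<K. w j * 0)"
  proof (rule weighted_bound)
    fix j assume j: "j < K"
    have "throughput a j t = serve (m j) (inflow a (throughput a) j) t"
      using throughput_eq_throughput[OF a] j assms(3) by (simp add: throughput_eq_def)
    also have "\<dots> \<le> inflow a (throughput a) j t"
      by (intro serve_le m_pos inflow_pos throughput_pos a j assms(3))
    finally show "throughput a j t \<le> 0 + (\<Sum>k<K. p k j * throughput a k t)"
      using assms(1)[OF j assms(3)] by (simp add: inflow_def)
  qed
  moreover have "0 \<le> throughput a j t" if "j < K" for j
    using strong_le_le[OF throughput_pos[OF a that] assms(3)] .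
  ultimately show ?thesis
    using member_le_sum[of i "{..<K}" "\<lambda>j. throughput a j t"] assms(2) by force
qed

end

section \<open>Measures and their distribution functions\<close>

lemma finite_borel_measure_iff:
  "finite_borel_measure M \<longleftrightarrow> finite_measure M \<and> sets M = sets borel"
  by (simp add: finite_borel_measure_def finite_borel_measure_axioms_def)

lemma fin_meas_Rp_borel: "fin_meas_Rp M \<Longrightarrow> finite_borel_measure M"
  by (simp add: fin_meas_Rp_def finite_borel_measure_iff)

text \<open>Half-lines form an intersection-stable generator, but the complement step compares total
  masses; these come from the limits of the distribution functions at infinity.\<close>

lemma measure_add_of_cdf_add:
  assumes A: "finite_borel_measure A" and B: "finite_borel_measure B" and C: "finite_borel_measure C"
    and eq: "\<And>x. cdf A x = cdf B x + cdf C x" and X: "X \<in> sets borel"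
  shows "measure A X = measure B X + measure C X"
proof -
  interpret A: finite_borel_measure A by fact
  interpret B: finite_borel_measure B by fact
  interpret C: finite_borel_measure C by fact
  have sp: "space A = UNIV" "space B = UNIV" "space C = UNIV"
    by (auto simp: A.borel_UNIV B.borel_UNIV C.borel_UNIV)
  have "(cdf A \<longlongrightarrow> measure B UNIV + measure C UNIV) at_top"
    using tendsto_add[OF B.cdf_lim_at_top C.cdf_lim_at_top] by (simp add: eq[abs_def] sp)
  with A.cdf_lim_at_top have UNIV: "measure A UNIV = measure B UNIV + measure C UNIV"
    using tendsto_unique[OF trivial_limit_at_top_linorder] by (fastforce simp: sp)
  have borel: "sigma_sets UNIV (range atMost) = sets (borel :: real measure)"
    unfolding borel_eq_atMost by simp
  have "Int_stable (range (atMost :: real \<Rightarrow> _))"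
    by (auto simp: Int_stable_def)
  moreover have "range (atMost :: real \<Rightarrow> _) \<subseteq> Pow UNIV"
    by simp
  moreover have "X \<in> sigma_sets UNIV (range atMost)"
    using X borel by simp
  ultimately show ?thesis
  proof (induction rule: sigma_sets_induct_disjoint)
    case (basic Y)
    then show ?case
      using eq by (auto simp: cdf_def)
  next
    case (compl Y)
    then have "Y \<in> sets borel"
      using borel by simp
    then show ?case
      using compl.IH A.finite_measure_compl[of Y] B.finite_measure_compl[of Y]
        C.finite_measure_compl[of Y] UNIV
      by (simp add: sp A.M_is_borel B.M_is_borel C.M_is_borel)
  next
    case (union Y)
    then have Y: "range Y \<subseteq> sets borel"
      using borel by simp
    have "(\<lambda>i. measure B (Y i) + measure C (Y i)) sums (measure B (\<Union>i. Y i) + measure C (\<Union>i. Y i))"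
      by (intro sums_add B.finite_measure_UNION C.finite_measure_UNION)
        (use Y union.hyps in \<open>auto simp: B.M_is_borel C.M_is_borel\<close>)
    moreover have "(\<lambda>i. measure A (Y i)) sums measure A (\<Union>i. Y i)"
      by (intro A.finite_measure_UNION) (use Y union.hyps in \<open>auto simp: A.M_is_borel\<close>)
    ultimately show ?case
      unfolding union.IH by (rule sums_unique2[rotated])
  qed simp
qed

lemma nn_integral_add_measures:
  assumes A: "sets A = sets M" and B: "sets B = sets M" and C: "sets C = sets M"
    and eq: "\<And>X. X \<in> sets M \<Longrightarrow> emeasure A X = emeasure B X + emeasure C X"
    and f: "f \<in> borel_measurable M"
  shows "integral\<^sup>N A f = integral\<^sup>N B f + integral\<^sup>N C f"
proof -
  note meas = measurable_cong_sets[OF A refl] measurable_cong_sets[OF B refl] measurable_cong_sets[OF C refl]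
  note sp = sets_eq_imp_space_eq[OF A] sets_eq_imp_space_eq[OF B] sets_eq_imp_space_eq[OF C]
  show ?thesis
    using f
  proof (induction rule: borel_measurable_induct)
    case (cong f g)
    have "integral\<^sup>N N f = integral\<^sup>N N g" if "space N = space M" for N
      by (rule nn_integral_cong) (use cong that in simp)
    then show ?case
      using cong sp by simp
  next
    case (set X)
    then show ?case
      by (simp add: nn_integral_indicator A B C eq)
  next
    case (mult u c)
    then show ?case
      by (simp add: nn_integral_cmult meas distrib_left)
  next
    case (add u v)
    then show ?case
      by (simp add: nn_integral_add meas ac_simps)
  next
    case (seq U)
    have mono: "incseq (\<lambda>i. integral\<^sup>N N (U i))" for N
      using seq(3) by (auto simp: incseq_def le_fun_def intro!: nn_integral_mono)
    have SUP: "integral\<^sup>N N (SUP i. U i) = (SUP i. integral\<^sup>N N (U i))" if "sets N = sets M" for N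
    proof -
      have "U i \<in> borel_measurable N" for i
        using seq(1) measurable_cong_sets[OF that refl] by blast
      then show ?thesis
        using nn_integral_monotone_convergence_SUP[OF seq(3), of N] by (simp add: SUP_apply[abs_def])
    qed
    then show ?case
      by (simp only: SUP[OF A] SUP[OF B] SUP[OF C] seq.IH ennreal_SUP_add[OF mono mono])
  qed
qed

lemma integrable_bounded_borel:
  fixes f :: "real \<Rightarrow> real"
  assumes "finite_borel_measure M" "f \<in> borel_measurable borel" "\<And>x. \<bar>f x\<bar> \<le> b"
  shows "integrable M f"
proof -
  interpret finite_borel_measure M by fact
  show ?thesis
    by (rule integrable_const_bound[of _ b])
      (use assms measurable_cong_sets[OF M_is_borel refl] in auto)
qed

text \<open>Integrals of the positive and negative parts of \<open>f\<close> are added separately;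
  boundedness of \<open>f\<close> keeps all of them finite, so that they may be converted to reals
  and subtracted.\<close>

lemma integral_add_of_cdf_add:
  fixes f :: "real \<Rightarrow> real"
  assumes A: "finite_borel_measure A" and B: "finite_borel_measure B" and C: "finite_borel_measure C"
    and eq: "\<And>x. cdf A x = cdf B x + cdf C x"
    and f: "f \<in> borel_measurable borel" "\<And>x. \<bar>f x\<bar> \<le> b"
  shows "integral\<^sup>L A f = integral\<^sup>L B f + integral\<^sup>L C f"
proof -
  interpret A: finite_borel_measure A by fact
  interpret B: finite_borel_measure B by fact
  interpret C: finite_borel_measure C by fact
  have em: "emeasure A X = emeasure B X + emeasure C X" if "X \<in> sets borel" for X
    using measure_add_of_cdf_add[OF A B C eq that]
    by (simp add: A.emeasure_eq_measure B.emeasure_eq_measure C.emeasure_eq_measure)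
  have nn: "integral\<^sup>N A g = integral\<^sup>N B g + integral\<^sup>N C g" if "g \<in> borel_measurable borel" for g
    using nn_integral_add_measures[of A borel B C g] em that
    by (simp add: A.M_is_borel B.M_is_borel C.M_is_borel)
  have fin: "(\<integral>\<^sup>+x. ennreal (g x) \<partial>M) < \<infinity>"
    if "finite_borel_measure M" "g \<in> borel_measurable borel" "\<And>x. \<bar>g x\<bar> \<le> b" for M and g :: "real \<Rightarrow> real"
  proof -
    have "(\<integral>\<^sup>+x. ennreal (g x) \<partial>M) \<le> (\<integral>\<^sup>+x. ennreal (norm (g x)) \<partial>M)"
      by (intro nn_integral_mono ennreal_leI) simp
    also have "\<dots> < \<infinity>"
      using integrable_bounded_borel[OF that] by (simp add: integrable_iff_bounded)
    finally show ?thesis .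
  qed
  have f': "(\<lambda>x. - f x) \<in> borel_measurable borel" "\<And>x. \<bar>- f x\<bar> \<le> b"
    using f by auto
  show ?thesis
    using fin[OF B f] fin[OF C f] fin[OF B f'] fin[OF C f'] f f'
    by (simp add: real_lebesgue_integral_def[OF integrable_bounded_borel[OF A f]]
        real_lebesgue_integral_def[OF integrable_bounded_borel[OF B f]]
        real_lebesgue_integral_def[OF integrable_bounded_borel[OF C f]]
        nn enn2real_plus)
qed

text \<open>Vanishing is asked only on the open negative half-line, so \<open>F 0\<close> may be
  positive: an atom at 0 is allowed. \<open>T\<close> is the total mass.\<close>

definition dist_fun :: "(real \<Rightarrow> real) \<Rightarrow> real \<Rightarrow> bool" where
  "dist_fun F T \<longleftrightarrow> mono F \<and> (\<forall>x<0. F x = 0) \<and> (\<forall>x. continuous (at_right x) F) \<and> (F \<longlongrightarrow> T) at_top"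

lemma dist_fun_at_bot:
  assumes "dist_fun F T"
  shows "(F \<longlongrightarrow> 0) at_bot"
proof (rule tendsto_eventually)
  show "\<forall>\<^sub>F x in at_bot. F x = 0"
    using assms unfolding eventually_at_bot_dense dist_fun_def by blast
qed

lemma dist_fun_le:
  assumes "dist_fun F T"
  shows "F x \<le> T"
proof (rule tendsto_lowerbound)
  show "(F \<longlongrightarrow> T) at_top"
    using assms by (simp add: dist_fun_def)
  show "\<forall>\<^sub>F y in at_top. F x \<le> F y"
    using assms unfolding eventually_at_top_linorder dist_fun_def mono_def by blast
qed simp

lemma dist_fun_nonneg:
  assumes "dist_fun F T"
  shows "0 \<le> F x"
proof -
  define y where "y = min x 0 - 1"
  have "y < 0" "y \<le> x"
    by (auto simp: y_def)
  then have "F y = 0" and "F y \<le> F x"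
    using assms unfolding dist_fun_def mono_def by blast+
  then show ?thesis
    by simp
qed

lemma interval_measure_dist_fun:
  assumes F: "dist_fun F T"
  shows "fin_meas_Rp (interval_measure F)"
    and "cdf (interval_measure F) = F"
    and "measure (interval_measure F) UNIV = T"
proof -
  have T: "0 \<le> T"
    using dist_fun_le[OF F] dist_fun_nonneg[OF F] order_trans by blast
  have *: "\<And>x y. x \<le> y \<Longrightarrow> F x \<le> F y" "\<And>x. continuous (at_right x) F" "(F \<longlongrightarrow> T) at_top"
    using F by (auto simp: dist_fun_def mono_def)
  note bot = dist_fun_at_bot[OF F]
  have fin: "finite_borel_measure (interval_measure F)"
    by (rule finite_borel_measure_interval_measure[OF *(1,2) bot *(3) T])
  show cdf: "cdf (interval_measure F) = F"
    by (rule cdf_interval_measure[OF *(1,2) bot])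
  show "measure (interval_measure F) UNIV = T"
    using interval_measure_UNIV[OF *(1,2) bot *(3) T] T by (simp add: measure_def)
  have "emeasure (interval_measure F) {..<0} \<le> 0"
  proof -
    \<comment> \<open>The distribution function controls closed half-lines, so the open one is
      exhausted by closed ones ending at -1/(n+1).\<close>
    have "emeasure (interval_measure F) {..- 1 / real (Suc n)} = 0" for n
      using emeasure_interval_measure_Iic[OF *(1,2) bot, of "- 1 / real (Suc n)"] F
      by (simp add: dist_fun_def)
    then have "emeasure (interval_measure F) (\<Union>n. {..- 1 / real (Suc n)}) = 0"
      by (intro emeasure_UN_eq_0) auto
    moreover have "{..<0} \<subseteq> (\<Union>n. {..- 1 / real (Suc n)})"
    proof
      fix x :: real assume "x \<in> {..<0}"
      then obtain n where "inverse (real (Suc n)) < - x"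
        using reals_Archimedean[of "- x"] by auto
      then show "x \<in> (\<Union>n. {..- 1 / real (Suc n)})"
        by (auto simp: inverse_eq_divide intro!: exI[of _ n])
    qed
    ultimately show ?thesis
      using emeasure_mono[of "{..<0}" "\<Union>n. {..- 1 / real (Suc n)}" "interval_measure F"] by (simp add: borel_closed)
  qed
  with fin show "fin_meas_Rp (interval_measure F)"
    by (simp add: fin_meas_Rp_def finite_borel_measure_iff)
qed

lemma dist_fun_cdf:
  assumes "fin_meas_Rp M"
  shows "dist_fun (cdf M) (measure M UNIV)"
proof -
  interpret finite_borel_measure M
    using assms by (rule fin_meas_Rp_borel)
  have "cdf M x = 0" if "x < 0" for x
  proof -
    have "emeasure M {..x} \<le> emeasure M {..<0}"
      using that by (intro emeasure_mono) (auto simp: M_is_borel)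
    then show ?thesis
      using assms by (simp add: cdf_def measure_def fin_meas_Rp_def)
  qed
  then show ?thesis
    using cdf_lim_at_top cdf_nondecreasing cdf_is_right_cont
    by (auto simp: dist_fun_def mono_def borel_UNIV)
qed

lemma fin_meas_Rp_Icc:
  assumes "fin_meas_Rp M" "0 \<le> x"
  shows "measure M {0..x} = cdf M x"
proof -
  interpret finite_borel_measure M
    using assms(1) by (rule fin_meas_Rp_borel)
  have "{..x} = {..<0} \<union> {0..x}"
    using assms(2) by auto
  moreover have "measure M ({..<0} \<union> {0..x}) = measure M {..<0} + measure M {0..x}"
    by (intro finite_measure_Union) (auto simp: M_is_borel)
  moreover have "measure M {..<0} = 0"
    using assms(1) by (simp add: fin_meas_Rp_def measure_def)
  ultimately show ?thesis
    by (simp add: cdf_def)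
qed

lemma fin_meas_Rp_atLeast:
  assumes "fin_meas_Rp M"
  shows "measure M {0..} = measure M UNIV"
proof -
  interpret finite_borel_measure M
    using assms(1) by (rule fin_meas_Rp_borel)
  have "(UNIV :: real set) = {..<0} \<union> {0..}"
    by auto
  moreover have "measure M ({..<0} \<union> {0..}) = measure M {..<0} + measure M {0..}"
    by (intro finite_measure_Union) (auto simp: M_is_borel)
  moreover have "measure M {..<0} = 0"
    using assms(1) by (simp add: fin_meas_Rp_def measure_def)
  ultimately show ?thesis
    by simp
qed

lemma measure_greaterThan:
  assumes "finite_borel_measure M"
  shows "measure M {x<..} = measure M UNIV - cdf M x"
proof -
  interpret finite_borel_measure M by fact
  have "{x<..} = space M - {..x}"
    by (auto simp: borel_UNIV)
  then show ?thesis
    using finite_measure_compl[of "{..x}"] by (simp add: cdf_def borel_UNIV M_is_borel)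
qed

lemma dist_fun_diff:
  assumes "dist_fun F T" "dist_fun G S" "mono (\<lambda>x. F x - G x)"
  shows "dist_fun (\<lambda>x. F x - G x) (T - S)"
  using assms by (auto simp: dist_fun_def intro!: tendsto_diff continuous_diff)

lemma integral_dist_fun_diff:
  fixes f :: "real \<Rightarrow> real"
  assumes F: "dist_fun F T" and G: "dist_fun G S" and mono: "mono (\<lambda>x. F x - G x)"
    and f: "f \<in> borel_measurable borel" "\<And>x. \<bar>f x\<bar> \<le> b"
  shows "integral\<^sup>L (interval_measure (\<lambda>x. F x - G x)) f
    = integral\<^sup>L (interval_measure F) f - integral\<^sup>L (interval_measure G) f"
proof -
  note FG = dist_fun_diff[OF F G mono]
  have "integral\<^sup>L (interval_measure F) f
    = integral\<^sup>L (interval_measure G) f + integral\<^sup>L (interval_measure (\<lambda>x. F x - G x)) f"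
    by (rule integral_add_of_cdf_add[OF _ _ _ _ f])
      (simp_all add: interval_measure_dist_fun[OF F] interval_measure_dist_fun[OF G]
        interval_measure_dist_fun[OF FG] fin_meas_Rp_borel)
  then show ?thesis
    by simp
qed

lemma integral_dist_fun_bound:
  fixes f :: "real \<Rightarrow> real"
  assumes F: "dist_fun F T" and f: "f \<in> borel_measurable borel" "\<And>x. \<bar>f x\<bar> \<le> b"
  shows "\<bar>integral\<^sup>L (interval_measure F) f\<bar> \<le> b * T"
proof -
  let ?M = "interval_measure F"
  have M: "finite_borel_measure ?M"
    by (rule fin_meas_Rp_borel[OF interval_measure_dist_fun(1)[OF F]])
  then interpret finite_borel_measure ?M .
  have "\<bar>integral\<^sup>L ?M f\<bar> \<le> (\<integral>x. \<bar>f x\<bar> \<partial>?M)"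
    using integral_norm_bound[of ?M f] by simp
  also have "\<dots> \<le> (\<integral>x. b \<partial>?M)"
    by (rule integral_mono) (use integrable_bounded_borel[OF M f] f in auto)
  also have "\<dots> = b * T"
    using interval_measure_dist_fun(3)[OF F] by simp
  finally show ?thesis .
qed

lemma bounded_continuous_borel:
  fixes f :: "real \<Rightarrow> real"
  assumes "continuous_on UNIV f" "bounded (range f)"
  obtains b where "f \<in> borel_measurable borel" "\<And>x. \<bar>f x\<bar> \<le> b"
  using assms by (auto simp: bounded_iff intro!: borel_measurable_continuous_onI)

text \<open>The distribution functions of the elements of \<open>D_up_M\<close>: \<open>F t x\<close> is the mass of \<open>[0,x]\<close> at
  time \<open>t\<close> and \<open>T t\<close> the total mass. Left limits of \<open>F\<close> in \<open>t\<close> are again distribution functions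
  because the increments over \<open>(x,y]\<close> are dominated by those at the later time.\<close>

definition cdf_flow :: "(real \<Rightarrow> real \<Rightarrow> real) \<Rightarrow> (real \<Rightarrow> real) \<Rightarrow> bool" where
  "cdf_flow F T \<longleftrightarrow> (\<forall>t\<ge>0. dist_fun (F t) (T t)) \<and> (\<forall>x. \<zero>\<^sub>p \<preceq> (\<lambda>t. F t x)) \<and>
     (\<forall>x y. x \<le> y \<longrightarrow> (\<lambda>t. F t x) \<preceq> (\<lambda>t. F t y)) \<and> (\<forall>t\<ge>0. (T \<longlongrightarrow> T t) (at_right t))"

lemma cdf_flow_mono_diff:
  assumes "cdf_flow F T" "0 \<le> s" "s \<le> t"
  shows "mono (\<lambda>x. F t x - F s x)"
  by (rule monoI) (use assms in \<open>auto simp: cdf_flow_def intro: strong_le_incr\<close>)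

text \<open>The comparison between levels \<open>x\<close> and \<open>y\<close> survives the limit
  of \<open>y\<close> to infinity.\<close>

lemma cdf_flow_le_total:
  assumes F: "cdf_flow F T"
  shows "(\<lambda>t. F t x) \<preceq> T"
proof (rule strong_le_lim)
  fix n :: nat
  show "(\<lambda>t. F t x) \<preceq> (\<lambda>t. F t (x + real n))"
    using F by (simp add: cdf_flow_def)
next
  fix t :: real assume "0 \<le> t"
  then have "(F t \<longlongrightarrow> T t) at_top"
    using F by (simp add: cdf_flow_def dist_fun_def)
  moreover have "filterlim (\<lambda>n. x + real n) at_top sequentially"
    by (rule filterlim_tendsto_add_at_top[OF tendsto_const filterlim_real_sequentially])
  ultimately show "(\<lambda>n. F t (x + real n)) \<longlonglongrightarrow> T t"
    by (rule filterlim_compose)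
qed simp

lemma cdf_flow_total_pos: "cdf_flow F T \<Longrightarrow> \<zero>\<^sub>p \<preceq> T"
  using cdf_flow_le_total[of F T 0] strong_le_trans[of "\<zero>\<^sub>p" "\<lambda>t. F t 0" T] by (auto simp: cdf_flow_def)

text \<open>For \<open>s > t\<close> the difference \<open>F s - F t\<close> is again a distribution
  function, of mass \<open>T s - T t\<close>. Integrals of \<open>f\<close> therefore differ by at
  most \<open>b * (T s - T t)\<close>, and right continuity of the total mass finishes the
  argument.\<close>

lemma cdf_flow_weak_right:
  assumes F: "cdf_flow F T" and t: "0 \<le> t"
  shows "weak_conv_along (at_right t) (\<lambda>s. interval_measure (F s)) (interval_measure (F t))"
  unfolding weak_conv_along_def
proof (intro allI impI)
  fix f :: "real \<Rightarrow> real" assume "continuous_on UNIV f \<and> bounded (range f)"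
  then obtain b where f: "f \<in> borel_measurable borel" "\<And>x. \<bar>f x\<bar> \<le> b"
    using bounded_continuous_borel by metis
  let ?I = "\<lambda>s. integral\<^sup>L (interval_measure (F s)) f"
  show "(?I \<longlongrightarrow> ?I t) (at_right t)"
  proof (rule Lim_null[THEN iffD2], rule Lim_null_comparison)
    have "eventually (\<lambda>s. t < s) (at_right t)"
      by (simp add: eventually_at_filter)
    then show "\<forall>\<^sub>F s in at_right t. norm (?I s - ?I t) \<le> b * (T s - T t)"
    proof (rule eventually_mono)
      fix s assume s: "t < s"
      have d: "dist_fun (F s) (T s)" "dist_fun (F t) (T t)" and m: "mono (\<lambda>x. F s x - F t x)"
        using F s t cdf_flow_mono_diff[OF F, of t s] by (auto simp: cdf_flow_def)
      show "norm (?I s - ?I t) \<le> b * (T s - T t)"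
        using integral_dist_fun_bound[OF dist_fun_diff[OF d m] f] integral_dist_fun_diff[OF d m f]
        by simp
    qed
    have "((\<lambda>s. b * (T s - T t)) \<longlongrightarrow> b * (T t - T t)) (at_right t)"
      using F t by (intro tendsto_intros) (auto simp: cdf_flow_def)
    then show "((\<lambda>s. b * (T s - T t)) \<longlongrightarrow> 0) (at_right t)"
      by simp
  qed
qed

lemma eventually_at_left_pos: "0 \<le> (s::real) \<Longrightarrow> s < t \<Longrightarrow> eventually (\<lambda>u. s < u \<and> u < t) (at_left t)"
  using eventually_at_left_real[of s t] by (auto elim: eventually_mono)

text \<open>Monotonicity in time gives pointwise left limits \<open>G\<close>, but these could lose
  right continuity in \<open>x\<close> or mass at infinity. Both are excluded by passing to the
  limit in the increment comparisons with time \<open>t\<close> (\<open>Gdiff\<close> and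
  \<open>GT\<close>). Integrals then converge as from the right, because \<open>G - F s\<close> has
  mass \<open>S - T s\<close>. The pointwise limit is kept in the conclusion for use with
  differences of flows.\<close>

lemma cdf_flow_weak_left:
  assumes F: "cdf_flow F T" and t: "0 < t"
  obtains G S where "dist_fun G S" "\<And>x. ((\<lambda>s. F s x) \<longlongrightarrow> G x) (at_left t)"
    and "weak_conv_along (at_left t) (\<lambda>s. interval_measure (F s)) (interval_measure G)"
proof -
  have Fpos: "\<And>x. \<zero>\<^sub>p \<preceq> (\<lambda>t. F t x)" and Fmono: "\<And>x y. x \<le> y \<Longrightarrow> (\<lambda>t. F t x) \<preceq> (\<lambda>t. F t y)"
    and Fdist: "\<And>t. 0 \<le> t \<Longrightarrow> dist_fun (F t) (T t)"
    using F by (auto simp: cdf_flow_def)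
  have Tpos: "\<zero>\<^sub>p \<preceq> T"
    by (rule cdf_flow_total_pos[OF F])
  obtain G where G: "\<And>x. ((\<lambda>s. F s x) \<longlongrightarrow> G x) (at_left t)"
    using strong_le_pos_left_limit[OF Fpos t] by metis
  obtain S where S: "(T \<longlongrightarrow> S) (at_left t)"
    using strong_le_pos_left_limit[OF Tpos t] by blast
  note ev = eventually_at_left_pos[OF order_refl t]
  note lim_le = tendsto_le[OF trivial_limit_at_left_real]
  have Gdiff: "G y - G x \<le> F t y - F t x" and Gmono: "G x \<le> G y" if "x \<le> y" for x y
  proof -
    show "G x \<le> G y"
      by (rule lim_le[OF G G], rule eventually_mono[OF ev])
        (use Fdist that in \<open>auto simp: dist_fun_def mono_def\<close>)
    show "G y - G x \<le> F t y - F t x"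
      by (rule lim_le[OF tendsto_const tendsto_diff[OF G G]], rule eventually_mono[OF ev])
        (use strong_le_incr[OF Fmono[OF that], of _ t] in \<open>simp add: algebra_simps\<close>)
  qed
  have GT: "S - G x \<le> T t - F t x" "G x \<le> S" for x
  proof -
    show "G x \<le> S"
      by (rule lim_le[OF S G], rule eventually_mono[OF ev])
        (use dist_fun_le[OF Fdist] in auto)
    show "S - G x \<le> T t - F t x"
      by (rule lim_le[OF tendsto_const tendsto_diff[OF S G]], rule eventually_mono[OF ev])
        (use strong_le_incr[OF cdf_flow_le_total[OF F], of _ t] in \<open>simp add: algebra_simps\<close>)
  qed
  have Ft: "dist_fun (F t) (T t)"
    using Fdist t by simp
  have dG: "dist_fun G S"
    unfolding dist_fun_def
  proof (intro conjI allI impI)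
    show "mono G"
      by (rule monoI) (rule Gmono)
    show "G x = 0" if "x < 0" for x
    proof (rule tendsto_unique[OF trivial_limit_at_left_real G])
      show "((\<lambda>s. F s x) \<longlongrightarrow> 0) (at_left t)"
        by (rule tendsto_eventually, rule eventually_mono[OF ev])
          (use Fdist that in \<open>auto simp: dist_fun_def\<close>)
    qed
    show "continuous (at_right x) G" for x
      unfolding continuous_within
    proof (rule tendsto_sandwich[of "\<lambda>_. G x" G "at_right x" "\<lambda>y. G x + (F t y - F t x)"])
      have ev: "eventually (\<lambda>y. x < y) (at_right x)"
        by (simp add: eventually_at_filter)
      show "\<forall>\<^sub>F y in at_right x. G x \<le> G y"
        using ev by (rule eventually_mono) (simp add: Gmono)
      show "\<forall>\<^sub>F y in at_right x. G y \<le> G x + (F t y - F t x)"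
        using ev
      proof (rule eventually_mono)
        fix y assume "x < y"
        then show "G y \<le> G x + (F t y - F t x)"
          using Gdiff[of x y] by simp
      qed
      have "((\<lambda>y. G x + (F t y - F t x)) \<longlongrightarrow> G x + (F t x - F t x)) (at_right x)"
        using Ft by (intro tendsto_intros) (simp add: dist_fun_def continuous_within)
      then show "((\<lambda>y. G x + (F t y - F t x)) \<longlongrightarrow> G x) (at_right x)"
        by simp
    qed simp
    show "(G \<longlongrightarrow> S) at_top"
    proof (rule tendsto_sandwich[of "\<lambda>x. S - (T t - F t x)" G at_top "\<lambda>_. S"])
      have "((\<lambda>x. S - (T t - F t x)) \<longlongrightarrow> S - (T t - T t)) at_top"
        using Ft by (intro tendsto_intros) (simp add: dist_fun_def)
      then show "((\<lambda>x. S - (T t - F t x)) \<longlongrightarrow> S) at_top"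
        by simp
      show "\<forall>\<^sub>F x in at_top. S - (T t - F t x) \<le> G x"
        using GT(1) by (intro always_eventually allI) (simp add: algebra_simps)
    qed (use GT(2) in auto)
  qed
  have "weak_conv_along (at_left t) (\<lambda>s. interval_measure (F s)) (interval_measure G)"
    unfolding weak_conv_along_def
  proof (intro allI impI)
    fix f :: "real \<Rightarrow> real" assume "continuous_on UNIV f \<and> bounded (range f)"
    then obtain b where f: "f \<in> borel_measurable borel" "\<And>x. \<bar>f x\<bar> \<le> b"
      using bounded_continuous_borel by metis
    let ?I = "\<lambda>s. integral\<^sup>L (interval_measure (F s)) f"
    show "(?I \<longlongrightarrow> integral\<^sup>L (interval_measure G) f) (at_left t)"
    proof (rule Lim_null[THEN iffD2], rule Lim_null_comparison)
      show "\<forall>\<^sub>F s in at_left t. norm (?I s - integral\<^sup>L (interval_measure G) f) \<le> b * (S - T s)"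
        using ev
      proof (rule eventually_mono)
        fix s assume s: "0 < s \<and> s < t"
        have ds: "dist_fun (F s) (T s)"
          using Fdist s by simp
        \<comment> \<open>For \<open>u\<close> between \<open>s\<close> and \<open>t\<close> the
          increments of \<open>F\<close> from \<open>s\<close> to \<open>u\<close> are ordered in
          \<open>x\<close>; let \<open>u\<close> tend to \<open>t\<close>.\<close>
        have m: "mono (\<lambda>x. G x - F s x)"
        proof (rule monoI)
          fix x y :: real assume xy: "x \<le> y"
          show "G x - F s x \<le> G y - F s y"
          proof (rule lim_le[OF tendsto_diff[OF G tendsto_const] tendsto_diff[OF G tendsto_const]])
            have "\<forall>\<^sub>F u in at_left t. s < u \<and> u < t"
              using s by (intro eventually_at_left_pos) auto
            then show "\<forall>\<^sub>F u in at_left t. F u x - F s x \<le> F u y - F s y"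
              by (rule eventually_mono) (use s strong_le_incr[OF Fmono[OF xy], of s] in simp)
          qed
        qed
        show "norm (?I s - integral\<^sup>L (interval_measure G) f) \<le> b * (S - T s)"
          using integral_dist_fun_bound[OF dist_fun_diff[OF dG ds m] f] integral_dist_fun_diff[OF dG ds m f]
          by (simp add: abs_minus_commute)
      qed
      have "((\<lambda>s. b * (S - T s)) \<longlongrightarrow> b * (S - S)) (at_left t)"
        by (intro tendsto_intros S)
      then show "((\<lambda>s. b * (S - T s)) \<longlongrightarrow> 0) (at_left t)"
        by simp
    qed
  qed
  with dG G show ?thesis
    using that by blast
qed

lemma cdf_flow_D_up_M:
  assumes F: "cdf_flow F T"
  shows "D_up_M (\<lambda>t. interval_measure (F t))"
  unfolding D_up_M_def cadlag_M_def
proof (intro conjI allI impI)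
  fix t :: real assume "0 \<le> t"
  then show "fin_meas_Rp (interval_measure (F t))"
    using F interval_measure_dist_fun(1) by (auto simp: cdf_flow_def)
  show "weak_conv_along (at_right t) (\<lambda>t. interval_measure (F t)) (interval_measure (F t))"
    by (rule cdf_flow_weak_right) fact+
next
  fix t :: real assume "0 < t"
  then show "\<exists>\<nu>. fin_meas_Rp \<nu> \<and> weak_conv_along (at_left t) (\<lambda>t. interval_measure (F t)) \<nu>"
    using cdf_flow_weak_left[OF F] interval_measure_dist_fun(1) by metis
next
  fix f :: "real \<Rightarrow> real" assume f: "continuous_on UNIV f \<and> bounded (range f) \<and> (\<forall>x. 0 \<le> f x)"
  then obtain b where b: "f \<in> borel_measurable borel" "\<And>x. \<bar>f x\<bar> \<le> b"
    using bounded_continuous_borel by metis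
  show "mono_on {0..} (\<lambda>t. integral\<^sup>L (interval_measure (F t)) f)"
  proof (rule mono_onI)
    fix s t :: real assume st: "s \<in> {0..}" "t \<in> {0..}" "s \<le> t"
    then have d: "dist_fun (F t) (T t)" "dist_fun (F s) (T s)" and m: "mono (\<lambda>x. F t x - F s x)"
      using F cdf_flow_mono_diff[OF F, of s t] by (auto simp: cdf_flow_def)
    have "0 \<le> integral\<^sup>L (interval_measure (\<lambda>x. F t x - F s x)) f"
      using f by (intro integral_nonneg_AE) auto
    then show "integral\<^sup>L (interval_measure (F s)) f \<le> integral\<^sup>L (interval_measure (F t)) f"
      using integral_dist_fun_diff[OF d m b] by simp
  qed
qed

text \<open>A queue is not monotone in time, so its path is handled as a difference of two flows,
  whose integrals converge separately. The left limit \<open>GA - GB\<close> is nondecreasing in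
  \<open>x\<close> as a pointwise limit of nondecreasing functions, hence again comes from a
  measure.\<close>

lemma cdf_flow_diff_cadlag_M:
  assumes A: "cdf_flow A T" and B: "cdf_flow B S"
    and mono: "\<And>t. 0 \<le> t \<Longrightarrow> mono (\<lambda>x. A t x - B t x)"
  shows "cadlag_M (\<lambda>t. interval_measure (\<lambda>x. A t x - B t x))"
  unfolding cadlag_M_def
proof (intro conjI allI impI)
  have dist: "dist_fun (A t) (T t)" "dist_fun (B t) (S t)" if "0 \<le> t" for t
    using A B that by (auto simp: cdf_flow_def)
  have diff: "integral\<^sup>L (interval_measure (\<lambda>x. A t x - B t x)) f
      = integral\<^sup>L (interval_measure (A t)) f - integral\<^sup>L (interval_measure (B t)) f"
    if "0 \<le> t" "continuous_on UNIV f \<and> bounded (range f)" for t and f :: "real \<Rightarrow> real"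
    using that bounded_continuous_borel[of f] integral_dist_fun_diff[OF dist(1,2) mono] by metis
  {
    fix t :: real assume t: "0 \<le> t"
    then show "fin_meas_Rp (interval_measure (\<lambda>x. A t x - B t x))"
      using interval_measure_dist_fun(1)[OF dist_fun_diff[OF dist mono]] by blast
    show "weak_conv_along (at_right t) (\<lambda>t. interval_measure (\<lambda>x. A t x - B t x))
        (interval_measure (\<lambda>x. A t x - B t x))"
      unfolding weak_conv_along_def
    proof (intro allI impI)
      fix f :: "real \<Rightarrow> real" assume f: "continuous_on UNIV f \<and> bounded (range f)"
      have lim: "((\<lambda>s. integral\<^sup>L (interval_measure (A s)) f - integral\<^sup>L (interval_measure (B s)) f)
          \<longlongrightarrow> integral\<^sup>L (interval_measure (\<lambda>x. A t x - B t x)) f) (at_right t)"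
        unfolding diff[OF t f]
        using cdf_flow_weak_right[OF A t] cdf_flow_weak_right[OF B t] f
        by (intro tendsto_diff) (auto simp: weak_conv_along_def)
      have "eventually (\<lambda>s. t < s) (at_right t)"
        by (simp add: eventually_at_filter)
      then have "\<forall>\<^sub>F s in at_right t.
          integral\<^sup>L (interval_measure (A s)) f - integral\<^sup>L (interval_measure (B s)) f
          = integral\<^sup>L (interval_measure (\<lambda>x. A s x - B s x)) f"
        by (rule eventually_mono) (use t diff f in auto)
      with lim show "((\<lambda>s. integral\<^sup>L (interval_measure (\<lambda>x. A s x - B s x)) f)
          \<longlongrightarrow> integral\<^sup>L (interval_measure (\<lambda>x. A t x - B t x)) f) (at_right t)"
        by (rule Lim_transform_eventually)
    qed
  next
    fix t :: real assume t: "0 < t"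
    obtain GA SA where GA: "dist_fun GA SA" "\<And>x. ((\<lambda>s. A s x) \<longlongrightarrow> GA x) (at_left t)"
      "weak_conv_along (at_left t) (\<lambda>s. interval_measure (A s)) (interval_measure GA)"
      using cdf_flow_weak_left[OF A t] by blast
    obtain GB SB where GB: "dist_fun GB SB" "\<And>x. ((\<lambda>s. B s x) \<longlongrightarrow> GB x) (at_left t)"
      "weak_conv_along (at_left t) (\<lambda>s. interval_measure (B s)) (interval_measure GB)"
      using cdf_flow_weak_left[OF B t] by blast
    note ev = eventually_at_left_pos[OF order_refl t]
    have m: "mono (\<lambda>x. GA x - GB x)"
    proof (rule monoI)
      fix x y :: real assume "x \<le> y"
      then show "GA x - GB x \<le> GA y - GB y"
        by (intro tendsto_le[OF trivial_limit_at_left_real tendsto_diff[OF GA(2) GB(2)]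
              tendsto_diff[OF GA(2) GB(2)]] eventually_mono[OF ev])
          (use mono in \<open>auto simp: mono_def\<close>)
    qed
    show "\<exists>\<nu>. fin_meas_Rp \<nu> \<and>
        weak_conv_along (at_left t) (\<lambda>t. interval_measure (\<lambda>x. A t x - B t x)) \<nu>"
    proof (intro exI conjI)
      show "fin_meas_Rp (interval_measure (\<lambda>x. GA x - GB x))"
        by (rule interval_measure_dist_fun(1)[OF dist_fun_diff[OF GA(1) GB(1) m]])
      show "weak_conv_along (at_left t) (\<lambda>t. interval_measure (\<lambda>x. A t x - B t x))
          (interval_measure (\<lambda>x. GA x - GB x))"
        unfolding weak_conv_along_def
      proof (intro allI impI)
        fix f :: "real \<Rightarrow> real" assume f: "continuous_on UNIV f \<and> bounded (range f)"
        then obtain b where b: "f \<in> borel_measurable borel" "\<And>x. \<bar>f x\<bar> \<le> b"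
          using bounded_continuous_borel by metis
        have lim: "((\<lambda>s. integral\<^sup>L (interval_measure (A s)) f - integral\<^sup>L (interval_measure (B s)) f)
            \<longlongrightarrow> integral\<^sup>L (interval_measure (\<lambda>x. GA x - GB x)) f) (at_left t)"
          unfolding integral_dist_fun_diff[OF GA(1) GB(1) m b]
          using GA(3) GB(3) f by (intro tendsto_diff) (auto simp: weak_conv_along_def)
        have "\<forall>\<^sub>F s in at_left t.
            integral\<^sup>L (interval_measure (A s)) f - integral\<^sup>L (interval_measure (B s)) f
            = integral\<^sup>L (interval_measure (\<lambda>x. A s x - B s x)) f"
          using ev by (rule eventually_mono) (use diff f in auto)
        with lim show "((\<lambda>s. integral\<^sup>L (interval_measure (\<lambda>x. A s x - B s x)) f)
            \<longlongrightarrow> integral\<^sup>L (interval_measure (\<lambda>x. GA x - GB x)) f) (at_left t)"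
          by (rule Lim_transform_eventually)
      qed
    qed
  }
qed

section \<open>From nondecreasing measure-valued paths back to flows of distribution
  functions\<close>

lemma D_up_M_measure_mono:
  assumes \<zeta>: "D_up_M \<zeta>" and st: "0 \<le> s" "s \<le> t" and X: "X \<in> sets borel"
    and cont: "\<And>n. continuous_on UNIV (f n)" and bnd: "\<And>n x. 0 \<le> f n x" "\<And>n x. f n x \<le> (1::real)"
    and lim: "\<And>x. (\<lambda>n. f n x) \<longlonglongrightarrow> indicator X x"
  shows "measure (\<zeta> s) X \<le> measure (\<zeta> t) X"
proof -
  have conv: "(\<lambda>n. integral\<^sup>L (\<zeta> u) (f n)) \<longlonglongrightarrow> measure (\<zeta> u) X" if "0 \<le> u" for u
  proof -
    have "fin_meas_Rp (\<zeta> u)"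
      using \<zeta> that by (simp add: D_up_M_def cadlag_M_def)
    then interpret finite_borel_measure "\<zeta> u"
      by (rule fin_meas_Rp_borel)
    have "(\<lambda>n. integral\<^sup>L (\<zeta> u) (f n)) \<longlonglongrightarrow> integral\<^sup>L (\<zeta> u) (indicator X)"
    proof (rule integral_dominated_convergence[where w = "\<lambda>_. 1"])
      show "f n \<in> borel_measurable (\<zeta> u)" for n
        using borel_measurable_continuous_onI[OF cont[of n]] measurable_cong_sets[OF M_is_borel refl] by blast
      show "indicat_real X \<in> borel_measurable (\<zeta> u)"
        using X by (intro borel_measurable_indicator) (simp add: M_is_borel)
    qed (use X lim bnd in \<open>auto simp: M_is_borel abs_of_nonneg\<close>)
    then show ?thesis
      using X by (simp add: M_is_borel borel_UNIV)
  qed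
  have "integral\<^sup>L (\<zeta> s) (f n) \<le> integral\<^sup>L (\<zeta> t) (f n)" for n
  proof -
    have "bounded (range (f n))"
      using bnd[of n] by (auto simp: bounded_iff intro!: exI[of _ 1])
    then have "mono_on {0..} (\<lambda>t. integral\<^sup>L (\<zeta> t) (f n))"
      using \<zeta> cont bnd by (auto simp: D_up_M_def)
    then show ?thesis
      using st by (auto simp: mono_on_def)
  qed
  then show ?thesis
    using conv st by (intro LIMSEQ_le[OF conv conv]) auto
qed

text \<open>Equal to 1 up to \<open>x\<close> and, for \<open>n > 0\<close>, falling linearly to 0
  on \<open>[x, x + 1/n]\<close>: a continuous approximation from above of the indicator of
  \<open>{..x}\<close>.\<close>

definition ramp :: "real \<Rightarrow> nat \<Rightarrow> real \<Rightarrow> real" where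
  "ramp x n u = max 0 (min 1 (1 - real n * (u - x)))"

lemma ramp_continuous: "continuous_on UNIV (ramp x n)"
  unfolding ramp_def by (intro continuous_intros)

lemma ramp_bounds: "0 \<le> ramp x n u" "ramp x n u \<le> 1"
  by (auto simp: ramp_def)

lemma ramp_mono: "x \<le> y \<Longrightarrow> ramp x n u \<le> ramp y n u"
  unfolding ramp_def by (intro max.mono min.mono order_refl diff_left_mono mult_left_mono) auto

lemma ramp_tendsto: "(\<lambda>n. ramp x n u) \<longlonglongrightarrow> indicator {..x} u"
proof (cases "u \<le> x")
  case True
  then have "real n * (u - x) \<le> 0" for n
    by (simp add: mult_nonneg_nonpos)
  then have "ramp x n u = 1" for n
    by (simp add: ramp_def)
  then show ?thesis
    using True by simp
next
  case False
  then obtain N where N: "1 < real N * (u - x)"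
    using reals_Archimedean3[of "u - x"] by auto
  have "ramp x n u = 0" if "n \<ge> N" for n
  proof -
    have "real N * (u - x) \<le> real n * (u - x)"
      using that False by (intro mult_right_mono) auto
    with N show ?thesis
      by (simp add: ramp_def)
  qed
  then have "\<forall>\<^sub>F n in sequentially. ramp x n u = 0"
    by (auto simp: eventually_sequentially)
  then show ?thesis
    using False by (simp add: tendsto_eventually)
qed

text \<open>The order in \<open>x\<close> says that the mass of \<open>(x,y]\<close> grows with
  time; the test function is \<open>ramp y n - ramp x n\<close>, nonnegative because both ramps have
  the same slope. Right continuity of the total mass is weak convergence tested on the constant
  1.\<close>

lemma D_up_M_cdf_flow:
  assumes \<zeta>: "D_up_M \<zeta>"
  shows "cdf_flow (\<lambda>t. cdf (\<zeta> t)) (\<lambda>t. measure (\<zeta> t) UNIV)"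
  unfolding cdf_flow_def
proof (intro conjI allI impI)
  have fin: "fin_meas_Rp (\<zeta> t)" if "0 \<le> t" for t
    using \<zeta> that by (simp add: D_up_M_def cadlag_M_def)
  show "dist_fun (cdf (\<zeta> t)) (measure (\<zeta> t) UNIV)" if "0 \<le> t" for t
    by (rule dist_fun_cdf[OF fin[OF that]])
  show "\<zero>\<^sub>p \<preceq> (\<lambda>t. cdf (\<zeta> t) x)" for x
  proof (rule strong_leI)
    fix s t :: real assume st: "0 \<le> s" "s \<le> t"
    have "measure (\<zeta> s) {..x} \<le> measure (\<zeta> t) {..x}"
      by (rule D_up_M_measure_mono[OF \<zeta> st _ ramp_continuous ramp_bounds ramp_tendsto]) simp
    then show "0 - 0 \<le> cdf (\<zeta> t) x - cdf (\<zeta> s) x"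
      by (simp add: cdf_def)
  qed (simp add: cdf_def)
  show "(\<lambda>t. cdf (\<zeta> t) x) \<preceq> (\<lambda>t. cdf (\<zeta> t) y)" if xy: "x \<le> y" for x y
  proof -
    have cdf_Ioc: "cdf (\<zeta> t) y - cdf (\<zeta> t) x = measure (\<zeta> t) {x<..y}" if "0 \<le> t" for t
      using finite_borel_measure.cdf_diff_eq[OF fin_meas_Rp_borel[OF fin[OF that]], of x y] xy
      by (cases "x = y") auto
    show ?thesis
    proof (rule strong_leI)
      show "cdf (\<zeta> 0) x \<le> cdf (\<zeta> 0) y"
        using finite_borel_measure.cdf_nondecreasing[OF fin_meas_Rp_borel[OF fin] xy, of 0] by simp
      fix s t :: real assume st: "0 \<le> s" "s \<le> t"
      have "measure (\<zeta> s) {x<..y} \<le> measure (\<zeta> t) {x<..y}"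
      proof (rule D_up_M_measure_mono[OF \<zeta> st, where f = "\<lambda>n u. ramp y n u - ramp x n u"])
        show "(\<lambda>n. ramp y n u - ramp x n u) \<longlonglongrightarrow> indicator {x<..y} u" for u
          using tendsto_diff[OF ramp_tendsto[of y u] ramp_tendsto[of x u]] xy
          by (auto simp: indicator_def split: if_splits)
        show "continuous_on UNIV (\<lambda>u. ramp y n u - ramp x n u)" for n
          by (intro continuous_on_diff ramp_continuous)
        show "0 \<le> ramp y n u - ramp x n u" "ramp y n u - ramp x n u \<le> 1" for n u
          using ramp_bounds(1)[of x n u] ramp_bounds(2)[of y n u] ramp_mono[OF xy, of n u] by auto
      qed simp
      then show "cdf (\<zeta> t) x - cdf (\<zeta> s) x \<le> cdf (\<zeta> t) y - cdf (\<zeta> s) y"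
        using cdf_Ioc[of s] cdf_Ioc[of t] st by simp
    qed
  qed
  show "((\<lambda>t. measure (\<zeta> t) UNIV) \<longlongrightarrow> measure (\<zeta> t) UNIV) (at_right t)" if t: "0 \<le> t" for t
  proof -
    have int: "integral\<^sup>L (\<zeta> s) (\<lambda>_. 1) = measure (\<zeta> s) UNIV" if "0 \<le> s" for s
      using finite_borel_measure.borel_UNIV[OF fin_meas_Rp_borel[OF fin[OF that]]] by simp
    have "((\<lambda>s. integral\<^sup>L (\<zeta> s) (\<lambda>_. 1::real)) \<longlongrightarrow> integral\<^sup>L (\<zeta> t) (\<lambda>_. 1)) (at_right t)"
    proof -
      have "weak_conv_along (at_right t) \<zeta> (\<zeta> t)"
        using \<zeta> t by (simp add: D_up_M_def cadlag_M_def)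
      note * = this[unfolded weak_conv_along_def, THEN spec, of "\<lambda>_. 1", THEN mp]
      have "continuous_on UNIV (\<lambda>_::real. 1::real)" "bounded (range (\<lambda>_::real. 1::real))"
        by auto
      then show ?thesis
        by (intro * conjI)
    qed
    moreover have "eventually (\<lambda>s. t < s) (at_right t)"
      by (simp add: eventually_at_filter)
    then have "\<forall>\<^sub>F s in at_right t. integral\<^sup>L (\<zeta> s) (\<lambda>_. 1) = measure (\<zeta> s) UNIV"
      by (rule eventually_mono) (use t int in auto)
    ultimately show ?thesis
      unfolding int[OF t] by (rule Lim_transform_eventually)
  qed
qed

section \<open>Closure properties of flows and of \<open>D_up\<close>\<close>

lemma cdf_flow_lincomb:
  assumes A: "cdf_flow A T" and B: "\<And>j. j \<in> J \<Longrightarrow> cdf_flow (B j) (S j)"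
    and q: "\<And>j. j \<in> J \<Longrightarrow> 0 \<le> q j"
  shows "cdf_flow (\<lambda>t x. A t x + (\<Sum>j\<in>J. q j * B j t x)) (\<lambda>t. T t + (\<Sum>j\<in>J. q j * S j t))"
  unfolding cdf_flow_def
proof (intro conjI allI impI)
  fix t :: real assume t: "0 \<le> t"
  have dA: "dist_fun (A t) (T t)" and dB: "\<And>j. j \<in> J \<Longrightarrow> dist_fun (B j t) (S j t)"
    using A B t by (auto simp: cdf_flow_def)
  show "dist_fun (\<lambda>x. A t x + (\<Sum>j\<in>J. q j * B j t x)) (T t + (\<Sum>j\<in>J. q j * S j t))"
    unfolding dist_fun_def
  proof (intro conjI allI impI)
    show "mono (\<lambda>x. A t x + (\<Sum>j\<in>J. q j * B j t x))"
      by (intro monoI add_mono sum_mono mult_left_mono q)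
        (use dA dB in \<open>auto simp: dist_fun_def mono_def\<close>)
    show "A t x + (\<Sum>j\<in>J. q j * B j t x) = 0" if "x < 0" for x
      using dA dB that by (auto simp: dist_fun_def)
    show "continuous (at_right x) (\<lambda>x. A t x + (\<Sum>j\<in>J. q j * B j t x))" for x
      by (intro continuous_add continuous_sum continuous_mult continuous_const)
        (use dA dB in \<open>auto simp: dist_fun_def\<close>)
    show "((\<lambda>x. A t x + (\<Sum>j\<in>J. q j * B j t x)) \<longlongrightarrow> T t + (\<Sum>j\<in>J. q j * S j t)) at_top"
      by (intro tendsto_add tendsto_sum tendsto_mult tendsto_const)
        (use dA dB in \<open>auto simp: dist_fun_def\<close>)
  qed
  show "((\<lambda>t. T t + (\<Sum>j\<in>J. q j * S j t)) \<longlongrightarrow> T t + (\<Sum>j\<in>J. q j * S j t)) (at_right t)"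
    by (intro tendsto_add tendsto_sum tendsto_mult tendsto_const)
      (use A B t in \<open>auto simp: cdf_flow_def\<close>)
next
  fix x
  have "(\<lambda>t. 0 + (\<Sum>j\<in>J. q j * 0)) \<preceq> (\<lambda>t. A t x + (\<Sum>j\<in>J. q j * B j t x))"
    by (intro strong_le_add strong_le_sum strong_le_scale q) (use A B in \<open>auto simp: cdf_flow_def\<close>)
  then show "\<zero>\<^sub>p \<preceq> (\<lambda>t. A t x + (\<Sum>j\<in>J. q j * B j t x))"
    by simp
next
  fix x y :: real assume "x \<le> y"
  then show "(\<lambda>t. A t x + (\<Sum>j\<in>J. q j * B j t x)) \<preceq> (\<lambda>t. A t y + (\<Sum>j\<in>J. q j * B j t y))"
    by (intro strong_le_add strong_le_sum strong_le_scale q) (use A B in \<open>auto simp: cdf_flow_def\<close>)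
qed

lemma cdf_flow_D_up_total: "cdf_flow F T \<Longrightarrow> D_up T"
  using cdf_flow_total_pos by (auto simp: D_up_iff cdf_flow_def)

lemma strong_le_D_up: "\<zero>\<^sub>p \<preceq> f \<Longrightarrow> f \<preceq> g \<Longrightarrow> D_up g \<Longrightarrow> D_up f"
  using right_cont_strong_le by (auto simp: D_up_iff)

lemma diff_D_up:
  assumes "\<zero>\<^sub>p \<preceq> f" "f \<preceq> g" "D_up g"
  shows "D_up (\<lambda>t. g t - f t)"
proof (rule strong_le_D_up[OF _ _ assms(3)])
  show "\<zero>\<^sub>p \<preceq> (\<lambda>t. g t - f t)"
    using assms(2) by (simp add: strong_le_diff_iff)
  show "(\<lambda>t. g t - f t) \<preceq> g"
    using assms(1) by (simp add: strong_le_def)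
qed

lemma cdf_flow_D_up: "cdf_flow F T \<Longrightarrow> D_up (\<lambda>t. F t x)"
  using strong_le_D_up[OF _ cdf_flow_le_total cdf_flow_D_up_total, of F x T]
  by (auto simp: cdf_flow_def)

lemma cdf_flow_D_up_tail: "cdf_flow F T \<Longrightarrow> D_up (\<lambda>t. T t - F t x)"
  using diff_D_up[OF _ cdf_flow_le_total cdf_flow_D_up_total, of F x T]
  by (auto simp: cdf_flow_def)

section \<open>Null sets of Stieltjes measures\<close>

text \<open>Flatness is known only to the right of each point, so the intervals
  \<open>{s<..<q s}\<close> omit \<open>s\<close> itself. Their union is null by Lindelof; the
  points of \<open>A\<close> left over are countably many, and none of them is an atom. As
  \<open>A\<close> is arbitrary, the conclusion provides a null superset.\<close>

lemma interval_measure_null_flat: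
  assumes mono: "\<And>x y. x \<le> y \<Longrightarrow> G x \<le> G y" and rc: "\<And>a. continuous (at_right a) G"
    and flat: "\<And>s. s \<in> A \<Longrightarrow> \<exists>e>0. G (s + e) = G s"
    and no_jump: "\<And>s e. s \<in> A \<Longrightarrow> 0 < e \<Longrightarrow> \<exists>u<s. G s < G u + e"
  shows "\<exists>N\<in>null_sets (interval_measure G). A \<subseteq> N"
proof -
  let ?M = "interval_measure G"
  note Ioc = emeasure_interval_measure_Ioc[OF _ mono rc]
  \<comment> \<open>A rational right endpoint is what later makes the exceptional points
    countable.\<close>
  have "\<exists>q\<in>\<rat>. s < q \<and> G q = G s" if s: "s \<in> A" for s
  proof -
    obtain e where e: "e > 0" "G (s + e) = G s"
      using flat[OF s] by blast
    obtain q where "q \<in> \<rat>" "s < q" "q < s + e"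
      using Rats_dense_in_real[of s "s + e"] e by auto
    then show ?thesis
      using mono[of s q] mono[of q "s + e"] e by (intro bexI[of _ q]) auto
  qed
  then obtain q where q: "\<And>s. s \<in> A \<Longrightarrow> q s \<in> \<rat>" "\<And>s. s \<in> A \<Longrightarrow> s < q s" "\<And>s. s \<in> A \<Longrightarrow> G (q s) = G s"
    by metis
  define I where "I s = {s<..<q s}" for s
  have I_null: "I s \<in> null_sets ?M" if "s \<in> A" for s
  proof (rule null_sets_subset)
    show "{s<..q s} \<in> null_sets ?M"
      using q(2,3)[OF that] Ioc[of s "q s"] by (auto simp: null_sets_def)
  qed (auto simp: I_def)
  have "open X" if "X \<in> I ` A" for X
    using that by (auto simp: I_def)
  then obtain B where B: "B \<subseteq> I ` A" "countable B" "\<Union>B = \<Union>(I ` A)"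
    by (rule Lindelof)
  have UB: "\<Union>B \<in> null_sets ?M"
    using null_sets_UN'[OF B(2), of "\<lambda>X. X" ?M] B(1) I_null by auto
  \<comment> \<open>The points of \<open>A\<close> outside the open intervals have pairwise disjoint \<open>I s\<close>, so they are countably many.\<close>
  have "inj_on q (A - \<Union>B)"
  proof (rule linorder_inj_onI)
    fix s t assume st: "s < t" "s \<in> A - \<Union>B" "t \<in> A - \<Union>B"
    then show "q s \<noteq> q t"
      using q(2)[of t] B(3) by (auto simp: I_def)
  qed auto
  moreover have "countable (q ` (A - \<Union>B))"
    by (rule countable_subset[OF _ countable_rat]) (use q in auto)
  ultimately have D: "countable (A - \<Union>B)"
    using countable_image_inj_on by blast
  have pt: "{s} \<in> null_sets ?M" if "s \<in> A" for s
  proof -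
    have "emeasure ?M {s} \<le> ennreal e" if e: "0 < e" for e
    proof -
      obtain u where u: "u < s" "G s < G u + e"
        using no_jump[OF \<open>s \<in> A\<close> e] by blast
      have "emeasure ?M {s} \<le> emeasure ?M {u<..s}"
        using u by (intro emeasure_mono) auto
      also have "\<dots> \<le> ennreal e"
        using u Ioc[of u s] by (simp add: ennreal_leI)
      finally show ?thesis .
    qed
    note le = this
    have "emeasure ?M {s} \<le> 0"
      by (rule ennreal_le_epsilon) (simp add: le)
    then show ?thesis
      by (simp add: null_sets_def)
  qed
  have "(\<Union>s\<in>A - \<Union>B. {s}) \<in> null_sets ?M"
    by (rule null_sets_UN'[OF D]) (use pt in auto)
  with UB have "\<Union>B \<union> (\<Union>s\<in>A - \<Union>B. {s}) \<in> null_sets ?M"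
    by (rule null_sets.Un)
  then show ?thesis
    by (rule rev_bexI) auto
qed

lemma stieltjes_extension:
  assumes "D_up g"
  shows "x \<le> y \<Longrightarrow> (if x < 0 then 0 else g x) \<le> (if y < 0 then 0 else g y)"
    and "continuous (at_right a) (\<lambda>s. if s < 0 then 0 else g s)"
proof -
  have g: "\<zero>\<^sub>p \<preceq> g" "\<And>t. 0 \<le> t \<Longrightarrow> (g \<longlongrightarrow> g t) (at_right t)"
    using assms by (auto simp: D_up_iff)
  show "(if x < 0 then 0 else g x) \<le> (if y < 0 then 0 else g y)" if "x \<le> y"
    using that strong_le_le[OF g(1), of y] strong_le_pos_mono[OF g(1), of x y] by auto
  show "continuous (at_right a) (\<lambda>s. if s < 0 then 0 else g s)"
    unfolding continuous_within
  proof (cases "a < 0")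
    case True
    then have "\<forall>\<^sub>F s in at_right a. (if s < 0 then 0 else g s) = 0"
      using eventually_at_right_real[OF True] by (auto elim: eventually_mono)
    then show "((\<lambda>s. if s < 0 then 0 else g s) \<longlongrightarrow> (if a < 0 then 0 else g a)) (at_right a)"
      using True by (simp add: tendsto_eventually)
  next
    case False
    have "eventually (\<lambda>s. a < s) (at_right a)"
      by (simp add: eventually_at_filter)
    then have "\<forall>\<^sub>F s in at_right a. g s = (if s < 0 then 0 else g s)"
      by (rule eventually_mono) (use False in auto)
    with g(2)[of a] show "((\<lambda>s. if s < 0 then 0 else g s) \<longlongrightarrow> (if a < 0 then 0 else g a)) (at_right a)"
      using False by (auto intro: Lim_transform_eventually)
  qed
qed

lemma stieltjes_cong: "(\<And>t. 0 \<le> t \<Longrightarrow> g t = g' t) \<Longrightarrow> stieltjes g = stieltjes g'"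
  unfolding stieltjes_def by (rule arg_cong[of _ _ interval_measure]) auto

text \<open>\<open>flat\<close> and \<open>no_jump\<close> make the positive times with
  \<open>f s \<noteq> 0\<close> null; at time 0, where the Stieltjes measure has an atom of size
  \<open>g 0\<close>, \<open>zero\<close> takes the place of \<open>no_jump\<close>.\<close>

lemma stieltjes_integral_zeroI:
  assumes g: "D_up g"
    and flat: "\<And>s. 0 \<le> s \<Longrightarrow> f s \<noteq> 0 \<Longrightarrow> \<exists>e>0. g (s + e) = g s"
    and no_jump: "\<And>s e. 0 < s \<Longrightarrow> f s \<noteq> 0 \<Longrightarrow> 0 < e \<Longrightarrow> \<exists>u\<ge>0. u < s \<and> g s < g u + e"
    and zero: "f 0 \<noteq> 0 \<Longrightarrow> g 0 = 0"
  shows "(\<integral>\<^sup>+ s \<in> {0..}. f s \<partial>stieltjes g) = 0"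
proof -
  let ?A = "{s. 0 \<le> s \<and> f s \<noteq> 0}"
  have "\<exists>N\<in>null_sets (stieltjes g). ?A \<subseteq> N"
    unfolding stieltjes_def
  proof (rule interval_measure_null_flat[OF stieltjes_extension[OF g]])
    fix s assume s: "s \<in> ?A"
    then obtain e where "e > 0" "g (s + e) = g s"
      using flat by auto
    then show "\<exists>e>0. (if s + e < 0 then 0 else g (s + e)) = (if s < 0 then 0 else g s)"
      using s by (intro exI[of _ e]) auto
    fix e :: real assume e: "0 < e"
    show "\<exists>u<s. (if s < 0 then 0 else g s) < (if u < 0 then 0 else g u) + e"
    proof (cases "s = 0")
      case True
      \<comment> \<open>Any negative point serves as witness: the extension vanishes there, and
        \<open>g 0 = 0\<close>.\<close>
      then show ?thesis
        using zero e s by (intro exI[of _ "- 1"]) auto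
    next
      case False
      then obtain u where "u \<ge> 0" "u < s" "g s < g u + e"
        using no_jump[of s e] s e by auto
      then show ?thesis
        by (intro exI[of _ u]) auto
    qed
  qed
  then obtain N where N: "N \<in> null_sets (stieltjes g)" "?A \<subseteq> N"
    by blast
  have "AE s in stieltjes g. f s * indicator {0..} s = 0"
    by (rule AE_I'[OF N(1)]) (use N(2) in \<open>auto simp: indicator_def\<close>)
  then have "(\<integral>\<^sup>+ s \<in> {0..}. f s \<partial>stieltjes g) = (\<integral>\<^sup>+ s. 0 \<partial>stieltjes g)"
    by (rule nn_integral_cong_AE)
  then show ?thesis
    by simp
qed

text \<open>Writing \<open>f\<close> as a difference of two monotone paths supplies its
  measurability, so the vanishing integral makes every Borel set of times \<open>s \<ge> 0\<close>
  with \<open>f s > 0\<close> null. Intervals \<open>{s<..t}\<close> then give constancy, and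
  singletons exclude jumps.\<close>

lemma stieltjes_integral_zeroD:
  assumes g: "D_up g" and c: "\<zero>\<^sub>p \<preceq> c" and b: "\<zero>\<^sub>p \<preceq> b"
    and f: "\<And>s. 0 \<le> s \<Longrightarrow> f s = c s - b s"
    and zero: "(\<integral>\<^sup>+ s \<in> {0..}. ennreal (f s) \<partial>stieltjes g) = 0"
  shows "0 \<le> s \<Longrightarrow> s < t \<Longrightarrow> (\<And>u. s < u \<Longrightarrow> u \<le> t \<Longrightarrow> 0 < f u) \<Longrightarrow> g s = g t"
    and "0 < f 0 \<Longrightarrow> g 0 = 0"
    and "0 < s \<Longrightarrow> 0 < f s \<Longrightarrow> 0 < e \<Longrightarrow> \<exists>u\<ge>0. u < s \<and> g s < g u + e"
proof -
  define G where "G s = (if s < 0 then 0 else g s)" for s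
  have M: "stieltjes g = interval_measure G"
    by (simp add: stieltjes_def G_def[abs_def])
  have G: "\<And>x y. x \<le> y \<Longrightarrow> G x \<le> G y" "\<And>a. continuous (at_right a) G"
    using stieltjes_extension[OF g] by (simp_all add: G_def[abs_def])
  note Ioc = emeasure_interval_measure_Ioc[OF _ G]
  have meas: "(\<lambda>s. if s < 0 then 0 else h s) \<in> borel_measurable borel" if h: "\<zero>\<^sub>p \<preceq> h" for h :: "real \<Rightarrow> real"
    by (rule borel_measurable_mono)
      (auto simp: mono_def strong_le_le[OF h] strong_le_pos_mono[OF h])
  have "(\<lambda>s. ennreal ((if s < 0 then 0 else c s) - (if s < 0 then 0 else b s)))
      \<in> borel_measurable (interval_measure G)"
    using meas[OF c] meas[OF b] by measurable
  moreover have "(\<lambda>s. ennreal ((if s < 0 then 0 else c s) - (if s < 0 then 0 else b s)))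
      = (\<lambda>s. ennreal (f s) * indicator {0..} s)"
    by (auto simp: f indicator_def)
  ultimately have "(\<lambda>s. ennreal (f s) * indicator {0..} s) \<in> borel_measurable (interval_measure G)"
    by simp
  then have "AE s in interval_measure G. ennreal (f s) * indicator {0..} s = 0"
    using zero by (simp add: M nn_integral_0_iff_AE)
  then obtain N where N: "N \<in> null_sets (interval_measure G)"
      "{s. ennreal (f s) * indicator {0..} s \<noteq> 0} \<subseteq> N"
    by (auto elim!: AE_E simp: null_sets_def)
  have null: "emeasure (interval_measure G) X = 0" if "X \<in> sets borel" "\<And>s. s \<in> X \<Longrightarrow> 0 \<le> s \<and> 0 < f s" for X
  proof -
    have "X \<subseteq> N"
      using N(2) that(2) by (force simp: indicator_def)
    then show ?thesis
      using N(1) that(1) null_sets_subset[of N "interval_measure G" X] by auto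
  qed
  show "g s = g t" if "0 \<le> s" "s < t" "\<And>u. s < u \<Longrightarrow> u \<le> t \<Longrightarrow> 0 < f u"
  proof -
    have "emeasure (interval_measure G) {s<..t} = 0"
      using that by (intro null) auto
    then have "G t - G s \<le> 0"
      using Ioc[of s t] that(1,2) by (simp add: ennreal_eq_0_iff)
    then show ?thesis
      using G(1)[of s t] that(1,2) by (simp add: G_def)
  qed
  \<comment> \<open>A jump of size at least \<open>e\<close> would leave mass at least
    \<open>e\<close> on every \<open>{s - 1/(n+1)<..s}\<close>, and by continuity from above on
    \<open>{s}\<close>, which is null. Time 0 is included, as the extension is 0 to its
    left.\<close>
  have jump: "\<exists>u<s. G s < G u + e" if s: "0 \<le> s" "0 < f s" and e: "0 < e" for s e
  proof (rule ccontr)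
    assume "\<not> (\<exists>u<s. G s < G u + e)"
    then have ge: "G u + e \<le> G s" if "u < s" for u
      using that by force
    have "decseq (\<lambda>n. {s - 1 / real (Suc n)<..s})"
      unfolding decseq_def
    proof (intro allI impI subsetI)
      fix m n :: nat and u assume mn: "m \<le> n" "u \<in> {s - 1 / real (Suc n)<..s}"
      have "1 / real (Suc n) \<le> 1 / real (Suc m)"
        using mn by (intro divide_left_mono) auto
      with mn show "u \<in> {s - 1 / real (Suc m)<..s}"
        by auto
    qed
    moreover have "emeasure (interval_measure G) {s - 1 / real (Suc n)<..s} \<noteq> \<infinity>" for n
      by (subst Ioc) auto
    ultimately have "(\<lambda>n. emeasure (interval_measure G) {s - 1 / real (Suc n)<..s})
        \<longlonglongrightarrow> emeasure (interval_measure G) (\<Inter>n. {s - 1 / real (Suc n)<..s})"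
      by (intro Lim_emeasure_decseq) auto
    moreover have "(\<Inter>n. {s - 1 / real (Suc n)<..s}) = {s}"
    proof (intro equalityI subsetI)
      fix u assume u: "u \<in> (\<Inter>n. {s - 1 / real (Suc n)<..s})"
      have "\<not> u < s"
      proof
        assume "u < s"
        then obtain n where "inverse (real (Suc n)) < s - u"
          using reals_Archimedean[of "s - u"] by auto
        moreover have "s - 1 / real (Suc n) < u"
          using u by auto
        ultimately show False
          by (simp add: inverse_eq_divide)
      qed
      with u show "u \<in> {s}"
        by auto
    qed auto
    moreover have "emeasure (interval_measure G) {s} = 0"
      using s by (intro null) auto
    ultimately have "(\<lambda>n. emeasure (interval_measure G) {s - 1 / real (Suc n)<..s}) \<longlonglongrightarrow> 0"
      by simp
    moreover have "ennreal e \<le> emeasure (interval_measure G) {s - 1 / real (Suc n)<..s}" for n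
      using ge[of "s - 1 / real (Suc n)"] by (subst Ioc) (auto intro!: ennreal_leI)
    ultimately have "ennreal e \<le> 0"
      by (intro LIMSEQ_le_const) auto
    then show False
      using e by simp
  qed
  show "g 0 = 0" if f0: "0 < f 0"
  proof (rule ccontr)
    assume "g 0 \<noteq> 0"
    moreover have "0 \<le> g 0"
      using g by (simp add: D_up_def)
    \<comment> \<open>With tolerance \<open>g 0\<close>, a point \<open>u < 0\<close>, where
      \<open>G u = 0\<close>, gives the contradiction \<open>g 0 < g 0\<close>.\<close>
    ultimately obtain u where "u < 0" "G 0 < G u + g 0"
      using jump[of 0 "g 0"] f0 by auto
    then show False
      by (simp add: G_def)
  qed
  show "\<exists>u\<ge>0. u < s \<and> g s < g u + e" if s: "0 < s" "0 < f s" "0 < e"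
  proof -
    obtain u where u: "u < s" "G s < G u + e"
      using jump[of s e] s by auto
    \<comment> \<open>The point found may be negative; by monotonicity it can be moved up to
      0.\<close>
    then have "G s < G (max u 0) + e"
      using G(1)[of u "max u 0"] by simp
    then show ?thesis
      using u s by (intro exI[of _ "max u 0"]) (auto simp: G_def)
  qed
qed

section \<open>Weights for a convergent substochastic matrix\<close>

text \<open>A spectral radius below 1 excludes the eigenvalue 1, so I - P is invertible and (I - P)
  w = 1 is solvable. Nonnegativity comes from a minimum principle instead of the Neumann
  series.\<close>

lemma substochastic_weights:
  assumes P: "substochastic K P" and sr: "spectral_radius (map_mat complex_of_real P) < 1"
  obtains w where "\<And>i. i < K \<Longrightarrow> 0 \<le> w i"
    and "\<And>i. i < K \<Longrightarrow> w i = 1 + (\<Sum>j<K. P $$ (i, j) * w j)"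
proof -
  have carr: "P \<in> carrier_mat K K" and nn: "\<And>i j. i < K \<Longrightarrow> j < K \<Longrightarrow> 0 \<le> P $$ (i, j)"
    and row: "\<And>i. i < K \<Longrightarrow> (\<Sum>j<K. P $$ (i, j)) \<le> 1"
    using P by (auto simp: substochastic_def)
  define A where "A = 1\<^sub>m K - P"
  have A: "A \<in> carrier_mat K K"
    unfolding A_def by (rule minus_carrier_mat[OF carr])
  have Pv: "(P *\<^sub>v v) $ i = (\<Sum>j<K. P $$ (i, j) * v $ j)" if "v \<in> carrier_vec K" "i < K" for v i
    using that carr by (auto simp: scalar_prod_def atLeast0LessThan intro!: sum.cong)
  have Av: "A *\<^sub>v v = v - P *\<^sub>v v" if "v \<in> carrier_vec K" for v
    unfolding A_def using minus_mult_distrib_mat_vec[OF one_carrier_mat carr that] that by simp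
  have "det A \<noteq> 0"
  proof
    assume "det A = 0"
    then obtain v where v: "v \<in> carrier_vec K" "v \<noteq> 0\<^sub>v K" "A *\<^sub>v v = 0\<^sub>v K"
      using det_0_iff_vec_prod_zero_field[OF A] by blast
    have fix_eq: "(\<Sum>j<K. P $$ (i, j) * v $ j) = v $ i" if "i < K" for i
    proof -
      have "(v - P *\<^sub>v v) $ i = 0"
        using v Av[OF v(1)] that by simp
      then show ?thesis
        using Pv[OF v(1) that] v(1) carr that by simp
    qed
    \<comment> \<open>The real fixed vector is read as a complex one, since the spectral radius is
      that of the complexified matrix.\<close>
    let ?v = "map_vec complex_of_real v" and ?P = "map_mat complex_of_real P"
    have "?P *\<^sub>v ?v = 1 \<cdot>\<^sub>v ?v"
    proof (rule eq_vecI)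
      fix i assume "i < dim_vec (1 \<cdot>\<^sub>v ?v)"
      then have i: "i < K"
        using v(1) by simp
      have "(?P *\<^sub>v ?v) $ i = (\<Sum>j<K. complex_of_real (P $$ (i, j) * v $ j))"
        using i v(1) carr by (auto simp: scalar_prod_def atLeast0LessThan intro!: sum.cong)
      also have "\<dots> = complex_of_real (v $ i)"
        unfolding of_real_sum[symmetric] fix_eq[OF i] ..
      finally show "(?P *\<^sub>v ?v) $ i = (1 \<cdot>\<^sub>v ?v) $ i"
        using i v(1) by simp
    qed (use carr v in auto)
    moreover have "?v \<noteq> 0\<^sub>v K"
    proof
      assume 0: "?v = 0\<^sub>v K"
      have "v = 0\<^sub>v K"
      proof (rule eq_vecI)
        fix i assume i: "i < dim_vec (0\<^sub>v K)"
        then have "?v $ i = 0"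
          using 0 by simp
        then show "v $ i = 0\<^sub>v K $ i"
          using i v(1) by simp
      qed (use v in auto)
      then show False
        using v by simp
    qed
    ultimately have "eigenvalue ?P 1"
      unfolding eigenvalue_def eigenvector_def using v(1) carr by (intro exI[of _ ?v]) auto
    then have "norm (1::complex) \<in> norm ` spectrum ?P"
      by (intro imageI) (simp add: spectrum_def)
    moreover have "K \<noteq> 0"
      using v by auto
    ultimately have "norm (1::complex) \<le> spectral_radius ?P"
      using spectral_radius_mem_max(2)[of ?P K] carr by auto
    then show False
      using sr by simp
  qed
  then have "A \<in> Units (ring_mat TYPE(real) K ())"
    by (rule det_non_zero_imp_unit[OF A])
  then obtain B where B: "B \<in> carrier_mat K K" "A * B = 1\<^sub>m K"
    by (auto simp: Units_def ring_mat_simps)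
  define v where "v = B *\<^sub>v vec K (\<lambda>_. 1)"
  have v: "v \<in> carrier_vec K"
    using B by (simp add: v_def)
  have "A *\<^sub>v v = vec K (\<lambda>_. 1)"
    unfolding v_def using A B by (simp flip: assoc_mult_mat_vec)
  then have eq: "v $ i = 1 + (\<Sum>j<K. P $$ (i, j) * v $ j)" if "i < K" for i
  proof -
    have "(v - P *\<^sub>v v) $ i = 1"
      using \<open>A *\<^sub>v v = vec K (\<lambda>_. 1)\<close> Av[OF v] that by simp
    then show ?thesis
      using Pv[OF v that] v carr that by simp
  qed
  \<comment> \<open>A negative minimum \<open>y\<close> of \<open>v\<close> would satisfy \<open>y \<ge> 1 + y\<close>, as the row sums are at most 1.\<close>
  have "0 \<le> v $ i" if i: "i < K" for i
  proof (rule ccontr)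
    assume neg: "\<not> 0 \<le> v $ i"
    define y where "y = Min ((\<lambda>j. v $ j) ` {..<K})"
    have y: "y \<le> v $ j" if "j < K" for j
      unfolding y_def using that by (intro Min_le) auto
    have "y \<in> (\<lambda>j. v $ j) ` {..<K}"
      unfolding y_def using i by (intro Min_in) auto
    then obtain k where k: "k < K" "y = v $ k"
      by auto
    have "y * 1 \<le> y * (\<Sum>j<K. P $$ (k, j))"
      using row[OF k(1)] neg y[OF i] by (intro mult_left_mono_neg) auto
    also have "\<dots> \<le> (\<Sum>j<K. P $$ (k, j) * v $ j)"
      unfolding sum_distrib_left using nn k y
      by (intro sum_mono) (auto simp: mult.commute[of "P $$ _"] intro!: mult_right_mono)
    also have "\<dots> = y - 1"
      using eq[OF k(1)] k by simp
    finally show False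
      by simp
  qed
  with eq show ?thesis
    using that[of "\<lambda>i. v $ i"] by blast
qed

section \<open>The measure-valued problem\<close>

lemma reflection_sum:
  fixes P :: "real mat"
  assumes "P \<in> carrier_mat K K" "i < K"
  shows "(\<Sum>j<K. (1\<^sub>m K - transpose_mat P) $$ (i, j) * b j) = b i - (\<Sum>j<K. P $$ (j, i) * b j)"
proof -
  have "(\<Sum>j<K. (1\<^sub>m K - transpose_mat P) $$ (i, j) * b j)
      = (\<Sum>j<K. (if i = j then b j else 0) - P $$ (j, i) * b j)"
    by (intro sum.cong refl) (use assms in \<open>auto simp: left_diff_distrib\<close>)
  then show ?thesis
    using assms(2) by (simp add: sum_subtractf)
qed

lemma fin_meas_Rp_eqI:
  assumes M: "fin_meas_Rp M" and N: "fin_meas_Rp N"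
    and eq: "\<And>x. 0 \<le> x \<Longrightarrow> measure M {0..x} = measure N {0..x}"
  shows "M = N"
proof (rule cdf_unique')
  show "cdf M = cdf N"
  proof
    fix x
    show "cdf M x = cdf N x"
    proof (cases "x < 0")
      case True
      then show ?thesis
        using dist_fun_cdf[OF M] dist_fun_cdf[OF N] by (simp add: dist_fun_def)
    next
      case False
      then show ?thesis
        using eq[of x] fin_meas_Rp_Icc[OF M, of x] fin_meas_Rp_Icc[OF N, of x] by simp
    qed
  qed
qed (use M N in \<open>auto intro: fin_meas_Rp_borel\<close>)

locale fed_network = network +
  fixes \<alpha> :: "nat \<Rightarrow> real \<Rightarrow> real measure"
  assumes m_D_up: "i < K \<Longrightarrow> D_up (m i)"
    and \<alpha>_D_up: "i < K \<Longrightarrow> D_up_M (\<alpha> i)"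
begin

section \<open>Arrivals and throughput up to a level\<close>

definition arr :: "real \<Rightarrow> nat \<Rightarrow> real \<Rightarrow> real" where
  "arr x i t = cdf (\<alpha> i t) x"

definition arr_total :: "nat \<Rightarrow> real \<Rightarrow> real" where
  "arr_total i t = measure (\<alpha> i t) UNIV"

lemma arr_flow: "i < K \<Longrightarrow> cdf_flow (\<lambda>t x. arr x i t) (arr_total i)"
  using D_up_M_cdf_flow[OF \<alpha>_D_up] by (simp add: arr_def[abs_def] arr_total_def[abs_def])

lemma arr_pos: "i < K \<Longrightarrow> \<zero>\<^sub>p \<preceq> arr x i"
  using arr_flow[of i] by (simp add: cdf_flow_def)

lemma arr_mono: "i < K \<Longrightarrow> x \<le> y \<Longrightarrow> arr x i \<preceq> arr y i"
  using arr_flow[of i] by (simp add: cdf_flow_def)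

lemma arr_le_total: "i < K \<Longrightarrow> arr x i \<preceq> arr_total i"
  using cdf_flow_le_total[OF arr_flow, of i x] by simp

lemma arr_total_pos: "i < K \<Longrightarrow> \<zero>\<^sub>p \<preceq> arr_total i"
  using cdf_flow_total_pos[OF arr_flow] .

abbreviation dep :: "real \<Rightarrow> nat \<Rightarrow> real \<Rightarrow> real" where
  "dep x \<equiv> throughput (arr x)"

text \<open>Level infinity: solved from the total arrivals instead of being defined as a limit in
  \<open>x\<close>; \<open>dep_flow\<close> shows that the two agree.\<close>

abbreviation dep_total :: "nat \<Rightarrow> real \<Rightarrow> real" where
  "dep_total \<equiv> throughput arr_total"

lemma dep_pos: "i < K \<Longrightarrow> \<zero>\<^sub>p \<preceq> dep x i"
  by (rule throughput_pos[OF arr_pos])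

lemma dep_total_pos: "i < K \<Longrightarrow> \<zero>\<^sub>p \<preceq> dep_total i"
  by (rule throughput_pos[OF arr_total_pos])

lemma dep_total_le: "i < K \<Longrightarrow> dep_total i \<preceq> m i"
  by (rule throughput_strong_le[OF arr_total_pos])

lemma dep_le_total: "i < K \<Longrightarrow> dep x i \<preceq> dep_total i"
  by (rule throughput_mono[OF arr_pos arr_le_total])

text \<open>Monotonicity in the level holds in \<open>\<preceq>\<close>, hence for all rectangles in
  time and level. Right continuity and the limit at infinity are squeezes by
  \<open>throughput_lipschitz\<close>, which reduce them to the same properties of the
  arrivals.\<close>

lemma dep_flow:
  assumes i: "i < K"
  shows "cdf_flow (\<lambda>t x. dep x i t) (dep_total i)"
  unfolding cdf_flow_def
proof (intro conjI allI impI)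
  have mono: "dep x i \<preceq> dep y i" if "x \<le> y" for x y
    by (rule throughput_mono[OF arr_pos arr_mono[OF _ that] i])
  then show "(\<lambda>t. dep x i t) \<preceq> (\<lambda>t. dep y i t)" if "x \<le> y" for x y
    using that by simp
  show "\<zero>\<^sub>p \<preceq> (\<lambda>t. dep x i t)" for x
    using dep_pos[OF i] by simp
  fix t :: real assume t: "0 \<le> t"
  have arr_dist: "dist_fun (\<lambda>x. arr x j t) (arr_total j t)" if "j < K" for j
    using arr_flow[OF that] t by (simp add: cdf_flow_def)
  show "(dep_total i \<longlongrightarrow> dep_total i t) (at_right t)"
    using strong_le_D_up[OF dep_total_pos dep_total_le m_D_up] i t by (simp add: D_up_iff)
  show "dist_fun (\<lambda>x. dep x i t) (dep_total i t)"
    unfolding dist_fun_def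
  proof (intro conjI allI impI)
    show "mono (\<lambda>x. dep x i t)"
      using strong_le_le[OF mono t] by (rule monoI)
    show "dep x i t = 0" if "x < 0" for x
    proof (rule throughput_zero[OF _ i t])
      fix j and s :: real assume "j < K" "0 \<le> s"
      then show "arr x j s = 0"
        using arr_flow[of j] that by (simp add: cdf_flow_def dist_fun_def)
    qed
    show "continuous (at_right x) (\<lambda>x. dep x i t)" for x
      unfolding continuous_within
    proof (rule tendsto_sandwich)
      have ev: "eventually (\<lambda>y. x < y) (at_right x)"
        by (simp add: eventually_at_filter)
      show "\<forall>\<^sub>F y in at_right x. dep x i t \<le> dep y i t"
        using ev by (rule eventually_mono) (simp add: strong_le_le[OF mono t])
      show "\<forall>\<^sub>F y in at_right x. dep y i t \<le> dep x i t + (\<Sum>j<K. w j * (arr y j t - arr x j t))"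
        using ev
      proof (rule eventually_mono)
        fix y assume "x < y"
        then have "dep y i t - dep x i t \<le> (\<Sum>j<K. w j * (arr y j t - arr x j t))"
          by (intro throughput_lipschitz[OF arr_pos arr_mono throughput_eq_throughput[OF arr_pos] t i]) auto
        then show "dep y i t \<le> dep x i t + (\<Sum>j<K. w j * (arr y j t - arr x j t))"
          by simp
      qed
      have "((\<lambda>y. dep x i t + (\<Sum>j<K. w j * (arr y j t - arr x j t)))
          \<longlongrightarrow> dep x i t + (\<Sum>j<K. w j * (arr x j t - arr x j t))) (at_right x)"
        by (intro tendsto_add tendsto_sum tendsto_mult tendsto_diff tendsto_const)
          (use arr_dist in \<open>auto simp: dist_fun_def continuous_within\<close>)
      then show "((\<lambda>y. dep x i t + (\<Sum>j<K. w j * (arr y j t - arr x j t))) \<longlongrightarrow> dep x i t) (at_right x)"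
        by simp
    qed simp
    show "((\<lambda>x. dep x i t) \<longlongrightarrow> dep_total i t) at_top"
    proof (rule tendsto_sandwich)
      have "dep_total i t - dep x i t \<le> (\<Sum>j<K. w j * (arr_total j t - arr x j t))" for x
        by (rule throughput_lipschitz[OF arr_pos arr_le_total throughput_eq_throughput[OF arr_total_pos] t i])
      then show "\<forall>\<^sub>F x in at_top. dep_total i t - (\<Sum>j<K. w j * (arr_total j t - arr x j t)) \<le> dep x i t"
        by (intro always_eventually allI) (simp add: algebra_simps)
      show "\<forall>\<^sub>F x in at_top. dep x i t \<le> dep_total i t"
        using strong_le_le[OF dep_le_total[OF i] t] by simp
      have "((\<lambda>x. dep_total i t - (\<Sum>j<K. w j * (arr_total j t - arr x j t)))
          \<longlongrightarrow> dep_total i t - (\<Sum>j<K. w j * (arr_total j t - arr_total j t))) at_top"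
        by (intro tendsto_diff tendsto_sum tendsto_mult tendsto_const)
          (use arr_dist in \<open>auto simp: dist_fun_def\<close>)
      then show "((\<lambda>x. dep_total i t - (\<Sum>j<K. w j * (arr_total j t - arr x j t))) \<longlongrightarrow> dep_total i t) at_top"
        by simp
    qed simp
  qed
qed

abbreviation inflow_upto :: "real \<Rightarrow> nat \<Rightarrow> real \<Rightarrow> real" where
  "inflow_upto x \<equiv> inflow (arr x) (dep x)"

lemma inflow_upto_flow:
  assumes "i < K"
  shows "cdf_flow (\<lambda>t x. inflow_upto x i t) (inflow arr_total dep_total i)"
  using cdf_flow_lincomb[OF arr_flow[OF assms], where J = "{..<K}" and q = "\<lambda>j. p j i"
      and B = "\<lambda>j t x. dep x j t" and S = dep_total] dep_flow p_nonneg assms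
  by (simp add: inflow_def[abs_def])

lemma inflow_upto_pos: "i < K \<Longrightarrow> \<zero>\<^sub>p \<preceq> inflow_upto x i"
  by (rule inflow_pos[OF arr_pos dep_pos])

lemma dep_eq_serve: "i < K \<Longrightarrow> 0 \<le> t \<Longrightarrow> dep x i t = serve (m i) (inflow_upto x i) t"
  using throughput_eq_throughput[OF arr_pos] by (simp add: throughput_eq_def)

section \<open>The solution triple and its complementarity\<close>

definition served :: "nat \<Rightarrow> real \<Rightarrow> real measure" where
  "served i t = interval_measure (\<lambda>x. dep x i t)"

definition queue :: "nat \<Rightarrow> real \<Rightarrow> real measure" where
  "queue i t = interval_measure (\<lambda>x. inflow_upto x i t - dep x i t)"

definition unused :: "nat \<Rightarrow> real \<Rightarrow> real" where
  "unused i t = m i t - dep_total i t"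

lemma served_D_up_M: "i < K \<Longrightarrow> D_up_M (served i)"
  using cdf_flow_D_up_M[OF dep_flow] by (simp add: served_def[abs_def])

lemma queue_mono:
  assumes "i < K" "0 \<le> t"
  shows "mono (\<lambda>x. inflow_upto x i t - dep x i t)"
  by (rule monoI, rule throughput_eq_diff[OF arr_pos arr_mono throughput_eq_throughput[OF arr_pos]])
    (use assms in auto)

lemma queue_cadlag_M: "i < K \<Longrightarrow> cadlag_M (queue i)"
  using cdf_flow_diff_cadlag_M[OF inflow_upto_flow dep_flow queue_mono]
  by (simp add: queue_def[abs_def])

lemma unused_D_up: "i < K \<Longrightarrow> D_up (unused i)"
  using diff_D_up[OF dep_total_pos dep_total_le m_D_up] by (simp add: unused_def[abs_def])

lemma
  assumes "i < K" "0 \<le> t"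
  shows served_fin: "fin_meas_Rp (served i t)" and served_cdf: "cdf (served i t) x = dep x i t"
    and served_UNIV: "measure (served i t) UNIV = dep_total i t"
proof -
  have "dist_fun (\<lambda>x. dep x i t) (dep_total i t)"
    using dep_flow assms by (simp add: cdf_flow_def)
  from interval_measure_dist_fun[OF this]
  show "fin_meas_Rp (served i t)" "cdf (served i t) x = dep x i t"
    "measure (served i t) UNIV = dep_total i t"
    by (simp_all add: served_def)
qed

lemma queue_Icc:
  assumes "i < K" "0 \<le> t" "0 \<le> x"
  shows "measure (queue i t) {0..x} = inflow_upto x i t - dep x i t"
proof -
  have "dist_fun (\<lambda>x. inflow_upto x i t) (inflow arr_total dep_total i t)"
    "dist_fun (\<lambda>x. dep x i t) (dep_total i t)"
    using dep_flow inflow_upto_flow assms by (simp_all add: cdf_flow_def)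
  from interval_measure_dist_fun(1,2)[OF dist_fun_diff[OF this queue_mono[OF assms(1,2)]]]
  show ?thesis
    using fin_meas_Rp_Icc[of "queue i t" x] assms(3) by (simp add: queue_def)
qed

text \<open>Stated for any \<open>g\<close> dominated by the regulator, so that (2) and (3) are two
  instances. Domination in increments makes \<open>g\<close> constant where the regulator is, keeps
  its jumps no larger, and forces \<open>g 0 = 0\<close> where the regulator starts at 0.\<close>

lemma queue_integral_zero:
  assumes i: "i < K" and x: "0 \<le> x" and g: "D_up g" and le: "g \<preceq> idle (m i) (inflow_upto x i)"
  shows "(\<integral>\<^sup>+ s \<in> {0..}. ennreal (measure (queue i s) {0..x}) \<partial>stieltjes g) = 0"
proof (rule stieltjes_integral_zeroI[OF g])
  note m = m_pos[OF i] and c = inflow_upto_pos[OF i, of x]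
  have g0: "\<zero>\<^sub>p \<preceq> g"
    using g by (simp add: D_up_iff)
  have busy: "serve (m i) (inflow_upto x i) s < inflow_upto x i s"
    if "0 \<le> s" "ennreal (measure (queue i s) {0..x}) \<noteq> 0" for s
    using queue_Icc[OF i that(1) x] dep_eq_serve[OF i that(1), of x] that(2)
      measure_nonneg[of "queue i s" "{0..x}"] by (simp add: less_le)
  {
    fix s assume s: "0 \<le> s" "ennreal (measure (queue i s) {0..x}) \<noteq> 0"
    have "(m i \<longlongrightarrow> m i s) (at_right s)" "(inflow_upto x i \<longlongrightarrow> inflow_upto x i s) (at_right s)"
      using m_D_up[OF i] cdf_flow_D_up[OF inflow_upto_flow[OF i], of x] s by (simp_all add: D_up_iff)
    then obtain e where e: "e > 0" "idle (m i) (inflow_upto x i) (s + e) = idle (m i) (inflow_upto x i) s"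
      using idle_right_flat[OF m c s(1) busy[OF s]] by blast
    then have "g (s + e) = g s"
      using strong_le_incr[OF le s(1), of "s + e"] strong_le_pos_mono[OF g0 s(1), of "s + e"] by simp
    with e show "\<exists>e>0. g (s + e) = g s"
      by blast
  next
    fix s e :: real assume s: "0 < s" "ennreal (measure (queue i s) {0..x}) \<noteq> 0" "0 < e"
    then obtain u where u: "0 \<le> u" "u < s"
      "idle (m i) (inflow_upto x i) s < idle (m i) (inflow_upto x i) u + e"
      using idle_no_jump[OF m c s(1) busy s(3)] by auto
    then show "\<exists>u\<ge>0. u < s \<and> g s < g u + e"
      using strong_le_incr[OF le u(1), of s] by (intro exI[of _ u]) auto
  next
    assume "ennreal (measure (queue i 0) {0..x}) \<noteq> 0"
    then have "idle (m i) (inflow_upto x i) 0 = 0"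
      by (intro idle_zero busy) auto
    then show "g 0 = 0"
      using strong_le_le[OF le, of 0] strong_le_le[OF g0, of 0] by simp
  }
qed

lemma idle_upto:
  "i < K \<Longrightarrow> 0 \<le> t \<Longrightarrow> m i t - dep x i t = idle (m i) (inflow_upto x i) t"
  using dep_eq_serve[of i t x] by (simp add: serve_def)

text \<open>The regulator \<open>m - dep x\<close> splits into the nondecreasing summands
  \<open>dep_total - dep x\<close> and \<open>m - dep_total\<close>. The first is the mass of
  \<open>served\<close> above \<open>x\<close>, and it is dominated because the second is
  nondecreasing.\<close>

lemma served_integral_zero:
  assumes "i < K" "0 \<le> x"
  shows "(\<integral>\<^sup>+ s \<in> {0..}. ennreal (measure (queue i s) {0..x})
    \<partial>stieltjes (\<lambda>s. measure (served i s) {x<..})) = 0"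
proof -
  have "stieltjes (\<lambda>s. measure (served i s) {x<..}) = stieltjes (\<lambda>s. dep_total i s - dep x i s)"
    by (rule stieltjes_cong)
      (simp add: measure_greaterThan fin_meas_Rp_borel assms served_fin served_cdf served_UNIV)
  moreover have "(\<lambda>s. dep_total i s - dep x i s) \<preceq> (\<lambda>s. m i s - dep x i s)"
    using dep_total_le[OF assms(1)] by (simp add: strong_le_def)
  then have "(\<lambda>s. dep_total i s - dep x i s) \<preceq> idle (m i) (inflow_upto x i)"
    by (rule strong_le_cong) (simp_all add: idle_upto assms)
  ultimately show ?thesis
    using queue_integral_zero[OF assms cdf_flow_D_up_tail[OF dep_flow]] assms by simp
qed

text \<open>The other summand of the regulator, dominated because \<open>dep_total - dep x\<close>
  is nondecreasing.\<close>

lemma unused_integral_zero: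
  assumes "i < K" "0 \<le> x"
  shows "(\<integral>\<^sup>+ s \<in> {0..}. ennreal (measure (queue i s) {0..x}) \<partial>stieltjes (unused i)) = 0"
proof (rule queue_integral_zero[OF assms unused_D_up[OF assms(1)]])
  have "unused i \<preceq> (\<lambda>s. m i s - dep x i s)"
    using dep_le_total[OF assms(1), of x] by (simp add: unused_def strong_le_def algebra_simps)
  then show "unused i \<preceq> idle (m i) (inflow_upto x i)"
    by (rule strong_le_cong) (simp_all add: idle_upto assms)
qed

lemma VMVSP_exists:
  assumes P: "P \<in> carrier_mat K K" and pP: "\<And>i j. i < K \<Longrightarrow> j < K \<Longrightarrow> p i j = P $$ (i, j)"
  shows "VMVSP K P \<alpha> m queue served unused"
  unfolding VMVSP_def Let_def
proof (intro conjI allI impI)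
  fix x t :: real and i assume x: "0 \<le> x" and i: "i < K" and t: "0 \<le> t"
  have "fin_meas_Rp (\<alpha> i t)"
    using \<alpha>_D_up[OF i] t by (simp add: D_up_M_def cadlag_M_def)
  then have "measure (\<alpha> i t) {0..x} = arr x i t"
    using fin_meas_Rp_Icc x by (simp add: arr_def)
  moreover have "measure (served j t) {0..x} = dep x j t" if "j < K" for j
    using fin_meas_Rp_Icc[OF served_fin x] served_cdf that t by simp
  ultimately show "measure (queue i t) {0..x} = measure (\<alpha> i t) {0..x}
      - (\<Sum>j<K. (1\<^sub>m K - transpose_mat P) $$ (i, j) * measure (served j t) {0..x})"
    unfolding reflection_sum[OF P i] using queue_Icc[OF i t x] i pP by (simp add: inflow_def)
next
  fix i and t :: real assume "i < K" "0 \<le> t"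
  then show "measure (served i t) {0..} + unused i t = m i t"
    by (simp add: fin_meas_Rp_atLeast served_fin served_UNIV unused_def)
qed (simp_all add: queue_cadlag_M served_D_up_M unused_D_up served_integral_zero unused_integral_zero)

text \<open>For an arbitrary solution, \<open>h\<close>, the sum of \<beta>(x,\<infinity>) and
  \<iota>, equals \<mu> - \<beta>[0,x] by (4), while (2) and (3) give it the pathwise properties
  demanded by \<open>idle_unique\<close>. So \<beta>[0,x] solves the fixed point equation, whose
  solution is unique.\<close>

lemma VMVSP_served:
  assumes P: "P \<in> carrier_mat K K" and pP: "\<And>i j. i < K \<Longrightarrow> j < K \<Longrightarrow> p i j = P $$ (i, j)"
    and sol: "VMVSP K P \<alpha> m \<xi> \<beta> \<iota>" and x: "0 \<le> x"
    and "i < K" "0 \<le> t"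
  shows "measure (\<beta> i t) {0..x} = dep x i t"
proof -
  have beta: "D_up_M (\<beta> i)" and iota: "D_up (\<iota> i)" if "i < K" for i
    using sol that by (auto simp: VMVSP_def Let_def)
  have fin_beta: "fin_meas_Rp (\<beta> i t)" and fin_alpha: "fin_meas_Rp (\<alpha> i t)" if "i < K" "0 \<le> t" for i t
    using beta \<alpha>_D_up that by (auto simp: D_up_M_def cadlag_M_def)
  define b where "b i t = cdf (\<beta> i t) x" for i t
  define T where "T i t = measure (\<beta> i t) UNIV" for i t
  have flow: "cdf_flow (\<lambda>t x. cdf (\<beta> i t) x) (T i)" if "i < K" for i
    using D_up_M_cdf_flow[OF beta[OF that]] by (simp add: T_def[abs_def])
  have b_pos: "\<zero>\<^sub>p \<preceq> b i" if "i < K" for i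
    using flow[OF that] by (simp add: cdf_flow_def b_def[abs_def])
  have b_Icc: "measure (\<beta> i t) {0..x} = b i t" if "i < K" "0 \<le> t" for i t
    using fin_meas_Rp_Icc[OF fin_beta x] that by (simp add: b_def)
  have xi: "measure (\<xi> i t) {0..x} = inflow (arr x) b i t - b i t" if i: "i < K" and t: "0 \<le> t" for i t
  proof -
    have "measure (\<xi> i t) {0..x} = measure (\<alpha> i t) {0..x}
        - (\<Sum>j<K. (1\<^sub>m K - transpose_mat P) $$ (i, j) * measure (\<beta> j t) {0..x})"
      using sol i t x by (simp add: VMVSP_def Let_def)
    then show ?thesis
      unfolding reflection_sum[OF P i]
      using fin_meas_Rp_Icc[OF fin_alpha x] b_Icc i t pP by (simp add: inflow_def arr_def)
  qed
  have "throughput_eq (arr x) b"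
    unfolding throughput_eq_def
  proof (intro allI impI conjI)
    fix i assume i: "i < K"
    show "\<zero>\<^sub>p \<preceq> b i"
      by (rule b_pos[OF i])
    define c where "c = inflow (arr x) b i"
    define h where "h t = (T i t - b i t) + \<iota> i t" for t
    have c: "\<zero>\<^sub>p \<preceq> c"
      unfolding c_def by (rule inflow_pos[OF arr_pos b_pos i])
    have tail: "D_up (\<lambda>t. T i t - b i t)"
      using cdf_flow_D_up_tail[OF flow[OF i], of x] by (simp add: b_def[abs_def])
    have hm: "h t = m i t - b i t" if "0 \<le> t" for t
    proof -
      have "measure (\<beta> i t) {0..} + \<iota> i t = m i t"
        using sol i that by (simp add: VMVSP_def Let_def)
      then show ?thesis
        using fin_meas_Rp_atLeast[OF fin_beta[OF i that]] by (simp add: h_def T_def)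
    qed
    have h: "\<zero>\<^sub>p \<preceq> h"
      using strong_le_add[of "\<zero>\<^sub>p" "\<lambda>t. T i t - b i t" "\<zero>\<^sub>p" "\<iota> i"] tail iota[OF i]
      by (simp add: D_up_iff h_def[abs_def])
    define f where "f t = measure (\<xi> i t) {0..x}" for t
    have f: "f t = c t - b i t" if "0 \<le> t" for t
      using xi[OF i that] by (simp add: f_def c_def)
    have f_pos_iff: "0 < f t \<longleftrightarrow> m i t - c t < h t" if "0 \<le> t" for t
      using f[OF that] hm[OF that] by auto
    have tail_eq: "stieltjes (\<lambda>s. measure (\<beta> i s) {x<..}) = stieltjes (\<lambda>s. T i s - b i s)"
      by (rule stieltjes_cong)
        (simp add: measure_greaterThan fin_meas_Rp_borel[OF fin_beta[OF i]] T_def b_def)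
    have z1: "(\<integral>\<^sup>+ s \<in> {0..}. ennreal (f s) \<partial>stieltjes (\<lambda>s. T i s - b i s)) = 0"
      and z2: "(\<integral>\<^sup>+ s \<in> {0..}. ennreal (f s) \<partial>stieltjes (\<iota> i)) = 0"
      using sol i x by (simp_all add: VMVSP_def Let_def f_def flip: tail_eq)
    note d1 = stieltjes_integral_zeroD[OF tail c b_pos[OF i] f z1]
    note d2 = stieltjes_integral_zeroD[OF iota[OF i] c b_pos[OF i] f z2]
    fix t :: real assume t: "0 \<le> t"
    have "h t = idle (m i) c t"
    proof (rule idle_unique[OF m_pos[OF i] c h _ _ _ _ t])
      fix t :: real assume "0 \<le> t"
      \<comment> \<open>This is the nonnegativity of \<xi>[0,x], which holds because \<xi> consists
        of measures.\<close>
      then show "m i t - c t \<le> h t"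
        using f[of t] hm[of t] measure_nonneg[of "\<xi> i t" "{0..x}"] by (simp add: f_def)
    next
      fix s t :: real assume st: "0 \<le> s" "s < t" "\<And>u. s < u \<Longrightarrow> u \<le> t \<Longrightarrow> m i u - c u < h u"
      then have "0 < f u" if "s < u" "u \<le> t" for u
        using that f_pos_iff[of u] by simp
      then show "h s = h t"
        using d1(1)[OF _ st(1,2)] d2(1)[OF _ st(1,2)] by (simp add: h_def)
    next
      assume "m i 0 - c 0 < h 0"
      then have "0 < f 0"
        using f_pos_iff[of 0] by simp
      then show "h 0 = 0"
        using d1(2) d2(2) by (simp add: h_def)
    next
      fix s e :: real assume s: "0 < s" "m i s - c s < h s" "0 < e"
      then have fs: "0 < f s" and e: "0 < e / 2"
        using f_pos_iff[of s] by simp_all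
      \<comment> \<open>Each of the two integrators gets half of the tolerance; by monotonicity the
        later of the points \<open>u\<close> and \<open>v\<close> works for their sum.\<close>
      obtain u where u: "u \<ge> 0" "u < s" "T i s - b i s < T i u - b i u + e / 2"
        using d1(3)[OF _ s(1) fs e] by auto
      obtain v where v: "v \<ge> 0" "v < s" "\<iota> i s < \<iota> i v + e / 2"
        using d2(3)[OF _ s(1) fs e] by auto
      have "T i u - b i u \<le> T i (max u v) - b i (max u v)"
        using strong_le_pos_mono[of "\<lambda>t. T i t - b i t" u "max u v"] tail u by (simp add: D_up_iff)
      moreover have "\<iota> i v \<le> \<iota> i (max u v)"
        using strong_le_pos_mono[of "\<iota> i" v "max u v"] iota[OF i] v by (simp add: D_up_iff)
      ultimately have "h s < h (max u v) + e"
        using u v by (simp add: h_def)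
      then show "\<exists>u. 0 \<le> u \<and> u < s \<and> h s < h u + e"
        using u v by (intro exI[of _ "max u v"]) auto
    qed
    then show "b i t = serve (m i) (inflow (arr x) b i) t"
      using hm[OF t] by (simp add: serve_def c_def)
  qed
  from throughput_unique[OF arr_pos this \<open>i < K\<close> \<open>0 \<le> t\<close>] show ?thesis
    using b_Icc \<open>i < K\<close> \<open>0 \<le> t\<close> by simp
qed

end

theorem theorem2p3:
  fixes K :: nat and P :: "real mat"
    and \<alpha> :: "nat \<Rightarrow> real \<Rightarrow> real measure" and \<mu> :: "nat \<Rightarrow> real \<Rightarrow> real"
  assumes "K \<ge> 1"
    and "P \<in> carrier_mat K K"
    and "substochastic K P"
    and "spectral_radius (map_mat complex_of_real P) < 1"
    and "\<forall>i<K. D_up_M (\<alpha> i)"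
    and "\<forall>i<K. D_up (\<mu> i)"
    and "\<forall>i<K. \<mu> i 0 = 0"
  shows "(\<exists>\<xi> \<beta> \<iota>. VMVSP K P \<alpha> \<mu> \<xi> \<beta> \<iota>) \<and>
         (\<forall>\<xi> \<beta> \<iota> \<xi>' \<beta>' \<iota>'. VMVSP K P \<alpha> \<mu> \<xi> \<beta> \<iota> \<longrightarrow> VMVSP K P \<alpha> \<mu> \<xi>' \<beta>' \<iota>' \<longrightarrow>
            (\<forall>i<K. \<forall>t\<ge>0. \<xi> i t = \<xi>' i t \<and> \<beta> i t = \<beta>' i t \<and> \<iota> i t = \<iota>' i t))"
proof -
  obtain w where w: "\<And>i. i < K \<Longrightarrow> 0 \<le> w i" "\<And>i. i < K \<Longrightarrow> w i = 1 + (\<Sum>j<K. P $$ (i, j) * w j)"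
    using substochastic_weights[OF assms(3,4)] by blast
  interpret fed_network K "\<lambda>i j. P $$ (i, j)" \<mu> w \<alpha>
  proof
    show "0 \<le> P $$ (i, j)" if "i < K" "j < K" for i j
      using assms(3) that by (simp add: substochastic_def)
    show "w i = 1 + (\<Sum>j<K. P $$ (i, j) * w j)" if "i < K" for i
      using w(2)[OF that] .
  qed (use assms w(1) in \<open>auto simp: D_up_iff\<close>)
  show ?thesis
  proof (intro conjI allI impI)
    show "\<exists>\<xi> \<beta> \<iota>. VMVSP K P \<alpha> \<mu> \<xi> \<beta> \<iota>"
      using VMVSP_exists[OF assms(2)] by blast
  next
    fix \<xi> \<beta> \<iota> \<xi>' \<beta>' \<iota>' and i :: nat and t :: real
    assume sol: "VMVSP K P \<alpha> \<mu> \<xi> \<beta> \<iota>" "VMVSP K P \<alpha> \<mu> \<xi>' \<beta>' \<iota>'" and i: "i < K" and t: "0 \<le> t"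
    have fin: "fin_meas_Rp (\<xi> i t)" "fin_meas_Rp (\<xi>' i t)" "fin_meas_Rp (\<beta> i t)" "fin_meas_Rp (\<beta>' i t)"
      using sol i t by (auto simp: VMVSP_def Let_def D_up_M_def cadlag_M_def)
    \<comment> \<open>Both solutions agree with \<open>dep\<close>. All stations \<open>j\<close>
      are covered, since (1) couples \<xi> at station \<open>i\<close> to every component of
      \<beta>.\<close>
    have Icc: "measure (\<beta> j t) {0..x} = measure (\<beta>' j t) {0..x}" if "j < K" "0 \<le> x" for j x
      using VMVSP_served[OF assms(2) _ sol(1) that(2,1) t] VMVSP_served[OF assms(2) _ sol(2) that(2,1) t]
      by simp
    show beta: "\<beta> i t = \<beta>' i t"
      by (rule fin_meas_Rp_eqI[OF fin(3,4) Icc[OF i]])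
    show "\<iota> i t = \<iota>' i t"
    proof -
      have "measure (\<beta> i t) {0..} + \<iota> i t = \<mu> i t" "measure (\<beta>' i t) {0..} + \<iota>' i t = \<mu> i t"
        using sol i t by (simp_all add: VMVSP_def Let_def)
      then show ?thesis
        using beta by simp
    qed
    show "\<xi> i t = \<xi>' i t"
    proof (rule fin_meas_Rp_eqI[OF fin(1,2)])
      fix x :: real assume x: "0 \<le> x"
      have eq: "measure (\<zeta> i t) {0..x} = measure (\<alpha> i t) {0..x}
          - (\<Sum>j<K. (1\<^sub>m K - transpose_mat P) $$ (i, j) * measure (\<gamma> j t) {0..x})"
        if "VMVSP K P \<alpha> \<mu> \<zeta> \<gamma> \<kappa>" for \<zeta> \<gamma> \<kappa>
        using that i t x by (simp add: VMVSP_def Let_def)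
      show "measure (\<xi> i t) {0..x} = measure (\<xi>' i t) {0..x}"
        unfolding eq[OF sol(1)] eq[OF sol(2)] using Icc x by simp
    qed
  qed
qed

end
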